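(* Let $\mathbb{F}$ be a subfield of a local field (with the inherited topology), let $\widehat{\mathbb{F}}$ be its completion, and let $n$ be a positive integer. The following conditions are equivalent: (1) $\mathrm{SL}(n,\mathbb{F})$ is minimal; (2) any non-trivial central subgroup of $\mathrm{SL}(n,\widehat{\mathbb{F}})$ intersects $\mathrm{SL}(n,\mathbb{F})$ non-trivially.
   Context: A local field is a non-discrete locally compact (Hausdorff) topological field; no restriction on the characteristic is made. If $\mathbb{F}$ is a subfield of a local field $P$, its completion $\widehat{\mathbb{F}}$ is identified with the closure of $\mathbb{F}$ in $P$. $\mathrm{SL}(n,\mathbb{F})$ is the group of $n\times n$ matrices of determinant $1$ with the pointwise topology inherited from $\mathbb{F}^{n^2}$. A central subgroup is a subgroup contained in the center. All topological groups are Hausdorff; a topological group is minimal if it admits no strictly coarser Hausdorff group topology. *)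

theory Defs
  imports "HOL-Analysis.Analysis" "HOL-Algebra.Algebraic_Closure_Type"
begin

text \<open>
  Joint continuity of addition and multiplication and continuity of negation come from the
  superclasses.
\<close>

class local_field = Fields.field + t2_space + topological_ab_group_add + topological_semigroup_mult +
  assumes tendsto_inverse_nhds: "a \<noteq> 0 \<Longrightarrow> (inverse \<longlongrightarrow> inverse a) (nhds a)"
    and locally_compact: "\<exists>U K. open U \<and> compact K \<and> x \<in> U \<and> U \<subseteq> K"
    and nondiscrete: "\<exists>S. \<not> open S"

text \<open>
  The topology is a parameter independent of the group structure, since minimality compares all
  group topologies on one fixed group.  Hausdorffness is part of the definition.
\<close>

definition hausdorff_group_topology :: "('g, 'm) monoid_scheme \<Rightarrow> 'g topology \<Rightarrow> bool"
  where "hausdorff_group_topology G T \<longleftrightarrow>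
    group G \<and> topspace T = carrier G \<and> Hausdorff_space T \<and>
    continuous_map (prod_topology T T) T (\<lambda>(x, y). x \<otimes>\<^bsub>G\<^esub> y) \<and>
    continuous_map T T (\<lambda>x. inv\<^bsub>G\<^esub> x)"

definition strictly_coarser :: "'g topology \<Rightarrow> 'g topology \<Rightarrow> bool"
  where "strictly_coarser T' T \<longleftrightarrow>
    topspace T' = topspace T \<and> {U. openin T' U} \<subset> {U. openin T U}"

definition minimal_topological_group :: "('g, 'm) monoid_scheme \<Rightarrow> 'g topology \<Rightarrow> bool"
  where "minimal_topological_group G T \<longleftrightarrow>
    hausdorff_group_topology G T \<and>
    \<not> (\<exists>T'. hausdorff_group_topology G T' \<and> strictly_coarser T' T)"

definition group_center :: "('g, 'm) monoid_scheme \<Rightarrow> 'g set"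
  where "group_center G = {z \<in> carrier G. \<forall>x \<in> carrier G. z \<otimes>\<^bsub>G\<^esub> x = x \<otimes>\<^bsub>G\<^esub> z}"

definition central_subgroup :: "'g set \<Rightarrow> ('g, 'm) monoid_scheme \<Rightarrow> bool"
  where "central_subgroup H G \<longleftrightarrow> subgroup H G \<and> H \<subseteq> group_center G"

text \<open>
  For a subfield \<open>F\<close> of the field \<open>'a\<close>, this is the group \<open>SL(n, F)\<close> with \<open>n = CARD('n)\<close>, realised
  inside the matrices over \<open>'a\<close>.
\<close>

definition SL :: "'a :: Fields.field set \<Rightarrow> ('a ^ 'n ^ 'n) monoid"
  where "SL F = \<lparr>carrier = {A. (\<forall>i j. A $ i $ j \<in> F) \<and> det A = 1}, mult = (**), one = mat 1\<rparr>"

text \<open>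
  The topology on \<open>'a ^ 'n ^ 'n\<close> is the product topology, so this is the topology of entrywise
  convergence, with \<open>F\<close> carrying the topology inherited from \<open>'a\<close>.
\<close>

definition SL_topology :: "'a :: {Fields.field, topological_space} set \<Rightarrow> ('a ^ 'n ^ 'n) topology"
  where "SL_topology F = top_of_set (carrier (SL F))"

end

theory Submission
  imports Defs
begin

text \<open>
  If a nontrivial central subgroup \<open>H\<close> over the closure meets \<open>SL F\<close> trivially, then \<open>SL F\<close>
  embeds into the quotient by \<open>H\<close> and inherits a Hausdorff topology, which is strictly coarser
  because every scalar matrix of determinant one over the closure is a limit of diagonal matrices
  in \<open>SL F\<close>.

  Conversely, for a coarser Hausdorff group topology let \<open>N\<close> be the intersection of the closures
  (in the matrix space) of its neighbourhoods of the identity.  It is a closed subgroup normalised by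
  \<open>SL F\<close> and meets \<open>SL F\<close> trivially.  If no such neighbourhood is bounded, conjugating small
  transvections by large elements produces an element \<open>1 + Y\<close> of \<open>N\<close> with \<open>Y\<close> nonzero of square
  zero; further conjugations and commutators contract it to a transvection in \<open>N\<close> with entries
  in \<open>F\<close>, which is impossible.  So some neighbourhood is bounded, hence \<open>N\<close> is bounded; being stable
  under conjugation by all transvections it consists of scalars, so it is trivial by hypothesis, and
  compactness gives equality of the topologies.  A subfield that is discrete in the local field
  is finite, and then there is nothing to prove.
\<close>

section \<open>Locally compact fields\<close>

no_notation fps_nth (infixl \<open>$\<close> 75)

section \<open>Separation and compactness for vectors and matrices\<close>

instance vec :: (t0_space, finite) t0_space
proof
  fix x y :: "'a ^ 'b"
  assume "x \<noteq> y"
  then obtain i where "x $ i \<noteq> y $ i"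
    by (auto simp: vec_eq_iff)
  then obtain U where U: "open U" "\<not> (x $ i \<in> U \<longleftrightarrow> y $ i \<in> U)"
    using separation_t0[of "x $ i" "y $ i"] by auto
  have "open ((\<lambda>z. z $ i) -` U)"
    by (simp add: U open_vimage_vec_nth)
  then show "\<exists>U. open U \<and> \<not> (x \<in> U \<longleftrightarrow> y \<in> U)"
    using U by (intro exI[of _ "(\<lambda>z. z $ i) -` U"]) auto
qed

instance vec :: (t1_space, finite) t1_space
proof
  fix x y :: "'a ^ 'b"
  assume "x \<noteq> y"
  then obtain i where "x $ i \<noteq> y $ i"
    by (auto simp: vec_eq_iff)
  then obtain U where U: "open U" "x $ i \<in> U" "y $ i \<notin> U"
    using separation_t1[of "x $ i" "y $ i"] by auto
  have "open ((\<lambda>z. z $ i) -` U)"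
    by (simp add: U open_vimage_vec_nth)
  then show "\<exists>U. open U \<and> x \<in> U \<and> y \<notin> U"
    using U by (intro exI[of _ "(\<lambda>z. z $ i) -` U"]) auto
qed

instance vec :: (t2_space, finite) t2_space
proof
  fix x y :: "'a ^ 'b"
  assume "x \<noteq> y"
  then obtain i where "x $ i \<noteq> y $ i"
    by (auto simp: vec_eq_iff)
  then obtain U V where UV: "open U" "open V" "x $ i \<in> U" "y $ i \<in> V" "U \<inter> V = {}"
    using hausdorff[OF \<open>x $ i \<noteq> y $ i\<close>] by blast
  have "open ((\<lambda>z. z $ i) -` U)" "open ((\<lambda>z. z $ i) -` V)"
    by (simp_all add: UV open_vimage_vec_nth)
  then show "\<exists>U V. open U \<and> open V \<and> x \<in> U \<and> y \<in> V \<and> U \<inter> V = {}"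
    using UV by (intro exI[of _ "(\<lambda>z. z $ i) -` U"] exI[of _ "(\<lambda>z. z $ i) -` V"]) auto
qed

instance local_field \<subseteq> topological_comm_monoid_mult ..

lemma compact_vec_pointwise:
  fixes K :: "'a :: topological_space set"
  assumes "compact K"
  shows "compact {x :: 'a ^ 'n. \<forall>i. x $ i \<in> K}"
proof -
  have "compactin (product_topology (\<lambda>_. euclidean) (UNIV :: 'n set)) (PiE UNIV (\<lambda>_. K))"
    using assms by (subst compactin_PiE) auto
  then have "compact (PiE (UNIV :: 'n set) (\<lambda>_. K))"
    by (simp add: euclidean_product_topology)
  moreover have "continuous_on (PiE (UNIV :: 'n set) (\<lambda>_. K)) (\<lambda>f. \<chi> i. f i)"
    by (intro continuous_on_vec_lambda continuous_on_subset[OF continuous_on_product_coordinates]) auto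
  ultimately have "compact ((\<lambda>f. \<chi> i. f i) ` PiE (UNIV :: 'n set) (\<lambda>_. K))"
    by (rule compact_continuous_image[rotated])
  also have "(\<lambda>f. \<chi> i. f i) ` PiE (UNIV :: 'n set) (\<lambda>_. K) = {x :: 'a ^ 'n. \<forall>i. x $ i \<in> K}"
    by (auto simp: image_iff intro!: bexI[of _ "vec_nth _"])
  finally show ?thesis .
qed

lemma compact_mat_pointwise:
  fixes K :: "'a :: topological_space set"
  assumes "compact K"
  shows "compact {A :: 'a ^ 'n ^ 'm. \<forall>i j. A $ i $ j \<in> K}"
  using compact_vec_pointwise[OF compact_vec_pointwise[OF assms], where 'n = 'm] by simp

section \<open>Inversion and multiplication in a local field\<close>

lemma continuous_on_inverse_local_field [continuous_intros]:
  fixes f :: "'b :: topological_space \<Rightarrow> 'a :: local_field"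
  assumes "continuous_on S f" "\<And>x. x \<in> S \<Longrightarrow> f x \<noteq> 0"
  shows "continuous_on S (\<lambda>x. inverse (f x))"
  unfolding continuous_on_def
proof
  fix x assume "x \<in> S"
  have "((\<lambda>y. inverse (f y)) \<longlongrightarrow> inverse (f x)) (at x within S)"
    by (rule filterlim_compose[OF tendsto_inverse_nhds])
      (use assms \<open>x \<in> S\<close> in \<open>auto simp: continuous_on_def\<close>)
  then show "((\<lambda>y. inverse (f y)) \<longlongrightarrow> inverse (f x)) (at x within S)" .
qed

lemma open_times_left:
  fixes a :: "'a :: local_field"
  assumes "open U" "a \<noteq> 0"
  shows "open ((*) a ` U)"
proof -
  have "(*) a ` U = (*) (inverse a) -` U"
    using assms(2) by (force simp: image_iff field_simps)
  then show ?thesis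
    using assms(1) by (auto intro!: open_vimage continuous_intros)
qed

lemma compact_times_left:
  fixes a :: "'a :: local_field"
  assumes "compact K"
  shows "compact ((*) a ` K)"
  using assms by (intro compact_continuous_image continuous_intros) auto

text \<open>The preimage of \<open>O'\<close> under multiplication is open and contains
  \<open>{0}\<close> times \<open>K\<close>, so the tube lemma gives a uniform
  \<open>W\<close>.\<close>

lemma small_times_compact:
  fixes K :: "'a :: local_field set"
  assumes "compact K" "open O'" "0 \<in> O'"
  obtains W where "open W" "0 \<in> W" "\<And>a x. a \<in> W \<Longrightarrow> x \<in> K \<Longrightarrow> a * x \<in> O'"
proof -
  have op: "open ((\<lambda>p :: 'a \<times> 'a. fst p * snd p) -` O')"
    using assms(2) by (intro open_vimage continuous_intros)
  obtain W where "0 \<in> W" "open W" "W \<times> K \<subseteq> (\<lambda>p :: 'a \<times> 'a. fst p * snd p) -` O'"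
    using Elementary_Topology.tube_lemma[OF assms(1) op, of 0] assms(3) by fastforce
  then show thesis
    by (intro that[of W]) auto
qed

text \<open>Replaces an element of absolute value less than one; no absolute value is available here.\<close>

lemma exists_contraction:
  fixes A :: "'a :: local_field set"
  assumes lim: "0 islimpt A"
  obtains p C U where "p \<in> A" "p \<noteq> 0" "compact C" "open U" "0 \<in> U" "U \<subseteq> C"
    "\<And>x. x \<in> C \<Longrightarrow> p * x \<in> C" "(\<lambda>n. p ^ n) \<longlonglongrightarrow> 0"
proof -
  obtain U C where UC: "open U" "compact C" "(0::'a) \<in> U" "U \<subseteq> C"
    using locally_compact[of 0] by blast
  obtain c where c: "c \<in> U" "c \<noteq> 0"
    using lim UC by (meson islimptE)
  \<comment> \<open>With \<open>c\<close> removed from the target, \<open>p * x\<close> differs from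
    \<open>c\<close> for every \<open>x\<close> in \<open>C\<close>. Hence
    \<open>inverse p * c\<close> lies outside \<open>C\<close>, which later excludes nonzero cluster
    points.\<close>
  have "open (U - {c})" "0 \<in> U - {c}"
    using UC c by auto
  then obtain W where W: "open W" "0 \<in> W" "\<And>a x. a \<in> W \<Longrightarrow> x \<in> C \<Longrightarrow> a * x \<in> U - {c}"
    using small_times_compact[OF UC(2)] by metis
  obtain p where p: "p \<in> A" "p \<in> W" "p \<noteq> 0"
    using lim W by (meson islimptE)
  have pC: "p * x \<in> C" if "x \<in> C" for x
    using W(3)[OF p(2) that] UC by auto
  have pc: "inverse p * c \<notin> C"
    using W(3)[OF p(2), of "inverse p * c"] p by auto
  have powC: "p ^ n * x \<in> C" if "x \<in> C" for n x
    using that by (induction n) (auto simp: mult.assoc pC)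
  define xs where "xs = (\<lambda>n::nat. p ^ n * c)"
  have xsC: "xs n \<in> C" for n
    using powC UC c by (auto simp: xs_def)
  obtain y where y: "y \<in> C" "inf (nhds y) (filtermap xs sequentially) \<noteq> bot"
    using UC(2)[unfolded compact_filter, rule_format, of "filtermap xs sequentially"] xsC
    by (auto simp: filtermap_bot_iff eventually_filtermap)
  have cluster: "\<exists>n\<ge>m. xs n \<in> V" if "open V" "y \<in> V" for V m
  proof (rule ccontr)
    assume "\<not> ?thesis"
    then have "eventually (\<lambda>x. x \<notin> V) (filtermap xs sequentially)"
      by (auto simp: eventually_filtermap eventually_sequentially)
    moreover have "eventually (\<lambda>x. x \<in> V) (nhds y)"
      using that by (simp add: eventually_nhds_in_open)
    ultimately have "eventually (\<lambda>x. False) (inf (nhds y) (filtermap xs sequentially))"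
      by (auto simp: eventually_inf)
    then show False
      using y(2) by (simp add: trivial_limit_def)
  qed
  \<comment> \<open>Near a nonzero cluster point some positive power of \<open>p\<close> is close to one, which would put
    \<open>inverse p * c\<close> into \<open>C\<close>.\<close>
  have "y = 0"
  proof (rule ccontr)
    assume "y \<noteq> 0"
    define V where "V = (\<lambda>r. inverse p * r * c) -` (- C)"
    have V: "open V" "1 \<in> V"
      using UC(2) pc by (auto simp: V_def compact_imp_closed intro!: open_vimage continuous_intros)
    have "((\<lambda>q. fst q * inverse (snd q)) \<longlongrightarrow> y * inverse y) (nhds (y, y))"
    proof (intro tendsto_mult)
      show "((\<lambda>q. fst q) \<longlongrightarrow> y) (nhds (y, y))"
        using tendsto_fst[of "\<lambda>q. q" "(y,y)" "nhds (y,y)"] by (simp add: filterlim_ident)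
      have "((\<lambda>q. snd q) \<longlongrightarrow> y) (nhds (y, y))"
        using tendsto_snd[of "\<lambda>q. q" "(y,y)" "nhds (y,y)"] by (simp add: filterlim_ident)
      then show "((\<lambda>q. inverse (snd q)) \<longlongrightarrow> inverse y) (nhds (y, y))"
        by (rule filterlim_compose[OF tendsto_inverse_nhds[OF \<open>y \<noteq> 0\<close>]])
    qed
    then have "eventually (\<lambda>q. fst q * inverse (snd q) \<in> V) (nhds (y, y))"
      using V \<open>y \<noteq> 0\<close> by (auto dest!: topological_tendstoD)
    then obtain Z where Z: "open Z" "(y, y) \<in> Z" "\<And>q. q \<in> Z \<Longrightarrow> fst q * inverse (snd q) \<in> V"
      unfolding eventually_nhds by blast
    obtain Y1 Y2 where Y: "open Y1" "open Y2" "y \<in> Y1" "y \<in> Y2" "Y1 \<times> Y2 \<subseteq> Z"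
      using Z by (auto elim: open_prod_elim)
    obtain n where n: "xs n \<in> Y2"
      using cluster Y by blast
    \<comment> \<open>A strictly later index makes the quotient of the two terms
      \<open>p * p ^ k\<close>, so that the factor \<open>inverse p\<close> in \<open>V\<close>
      cancels and \<open>p ^ k * c\<close> remains.\<close>
    obtain m where m: "m \<ge> Suc n" "xs m \<in> Y1"
      using cluster Y by blast
    have "xs m * inverse (xs n) \<in> V"
      using Z(3)[of "(xs m, xs n)"] m n Y by auto
    moreover obtain k where k: "m = Suc n + k"
      using m(1) le_Suc_ex by blast
    moreover have "xs m * inverse (xs n) = p * p ^ k"
      using p c by (simp add: xs_def k power_add field_simps)
    ultimately have "p * p ^ k \<in> V"
      by simp
    then have "p ^ k * c \<notin> C"
      using p by (simp add: V_def mult.assoc[symmetric])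
    then show False
      using powC UC c by auto
  qed
  have "xs \<longlonglongrightarrow> 0"
  proof (rule topological_tendstoI)
    fix S :: "'a set" assume "open S" "0 \<in> S"
    then obtain W' where W': "open W'" "0 \<in> W'" "\<And>a x. a \<in> W' \<Longrightarrow> x \<in> C \<Longrightarrow> a * x \<in> S"
      using small_times_compact[OF UC(2)] by metis
    \<comment> \<open>A single power \<open>p ^ m\<close> in \<open>W'\<close> is enough: each later
      term is \<open>p ^ m\<close> times \<open>p ^ (n - m) * c\<close>, and the second factor lies
      in \<open>C\<close>.\<close>
    have "open ((\<lambda>x. x * inverse c) -` W')"
      using W' by (intro open_vimage continuous_intros)
    then obtain m where "xs m * inverse c \<in> W'"
      using cluster[of "(\<lambda>x. x * inverse c) -` W'" 0] \<open>y = 0\<close> W' by auto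
    then have m: "p ^ m \<in> W'"
      using c by (simp add: xs_def mult.assoc)
    have "xs n \<in> S" if "n \<ge> m" for n
      using W'(3)[OF m powC, of c "n - m"] that UC c
      by (auto simp: xs_def mult.assoc[symmetric] power_add[symmetric])
    then show "eventually (\<lambda>n. xs n \<in> S) sequentially"
      by (auto simp: eventually_sequentially)
  qed
  then have "(\<lambda>n. xs n * inverse c) \<longlonglongrightarrow> 0"
    using tendsto_mult_right[of xs 0 sequentially "inverse c"] by simp
  then have "(\<lambda>n. p ^ n) \<longlonglongrightarrow> 0"
    using c by (simp add: xs_def)
  with p UC pC show thesis
    by (intro that)
qed

lemma tendsto_zero_times_bounded:
  fixes f g :: "'b \<Rightarrow> 'a :: local_field"
  assumes "(f \<longlongrightarrow> 0) G" "compact K" "\<And>x. g x \<in> K"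
  shows "((\<lambda>x. f x * g x) \<longlongrightarrow> 0) G"
proof (rule topological_tendstoI)
  fix S :: "'a set" assume "open S" "0 \<in> S"
  then obtain W where W: "open W" "0 \<in> W" "\<And>a x. a \<in> W \<Longrightarrow> x \<in> K \<Longrightarrow> a * x \<in> S"
    using small_times_compact[OF assms(2)] by metis
  have "eventually (\<lambda>x. f x \<in> W) G"
    using assms(1) W by (auto dest: topological_tendstoD)
  then show "eventually (\<lambda>x. f x * g x \<in> S) G"
    by eventually_elim (use W assms(3) in auto)
qed

section \<open>Compact balls attached to a contracting element\<close>

locale contraction =
  fixes p :: "'a :: local_field" and C B :: "'a set"
  assumes p_nonzero: "p \<noteq> 0"
    and compact_C: "compact C" and open_B: "open B" and zero_B: "0 \<in> B" and B_sub_C: "B \<subseteq> C"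
    and p_C: "\<And>x. x \<in> C \<Longrightarrow> p * x \<in> C" and p_power: "(\<lambda>n. p ^ n) \<longlonglongrightarrow> 0"
begin

no_notation fps_nth (infixl \<open>$\<close> 75)

lemma power_C: "x \<in> C \<Longrightarrow> p ^ n * x \<in> C"
  by (induction n) (auto simp: mult.assoc p_C)

lemma compact_absorbed:
  assumes "compact K" "open V" "0 \<in> V"
  shows "\<exists>n0. \<forall>n\<ge>n0. \<forall>x\<in>K. p ^ n * x \<in> V"
proof -
  obtain W where W: "open W" "0 \<in> W" "\<And>a x. a \<in> W \<Longrightarrow> x \<in> K \<Longrightarrow> a * x \<in> V"
    using small_times_compact[OF assms] by metis
  have "eventually (\<lambda>n. p ^ n \<in> W) sequentially"
    using p_power W by (auto dest: topological_tendstoD)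
  then show ?thesis
    using W by (auto simp: eventually_sequentially)
qed

text \<open>This is \<open>C\<close> dilated by the \<open>n\<close>-th power of
  \<open>inverse p\<close>. The sets increase with \<open>n\<close> and every compact set lies in
  one of them, so they replace the closed balls of an absolute value.\<close>

definition ball_p :: "nat \<Rightarrow> 'a set" where "ball_p n = {x. p ^ n * x \<in> C}"

lemma compact_ball_p: "compact (ball_p n)"
proof -
  have "ball_p n = (*) (inverse (p ^ n)) ` C"
    using p_nonzero by (force simp: ball_p_def image_iff field_simps)
  then show ?thesis
    by (simp add: compact_times_left compact_C)
qed

lemma ball_p_mono: "m \<le> n \<Longrightarrow> ball_p m \<subseteq> ball_p n"
  using power_C[of "p ^ m * x" "n - m" for x]
  by (auto simp: ball_p_def mult.assoc[symmetric] power_add[symmetric] simp del: mult.assoc)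

lemma compact_sub_ball_p:
  assumes "compact K"
  shows "\<exists>n. K \<subseteq> ball_p n"
  using compact_absorbed[OF assms open_B zero_B] B_sub_C by (fastforce simp: ball_p_def)

lemma sphere_entry:
  assumes fin: "finite I" and out: "\<exists>i\<in>I. x i \<notin> ball_p M"
  obtains n where "n > M" "\<And>i. i \<in> I \<Longrightarrow> p ^ n * x i \<in> C" "\<exists>i\<in>I. p ^ n * x i \<notin> (*) p ` B"
proof -
  have "\<exists>n. x ` I \<subseteq> ball_p n"
    using fin by (intro compact_sub_ball_p finite_imp_compact) auto
  then have ex: "\<exists>n. \<forall>i\<in>I. x i \<in> ball_p n"
    by blast
  define n where "n = (LEAST n. \<forall>i\<in>I. x i \<in> ball_p n)"
  have n: "\<forall>i\<in>I. x i \<in> ball_p n"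
    unfolding n_def using ex by (rule LeastI_ex)
  have less: "\<not> (\<forall>i\<in>I. x i \<in> ball_p m)" if "m < n" for m
    using not_less_Least that unfolding n_def by blast
  have "M < n"
    using out n ball_p_mono[of n M] by (meson not_le subsetD)
  then obtain k where k: "n = Suc k"
    using gr0_implies_Suc by (cases n) auto
  obtain i where i: "i \<in> I" "x i \<notin> ball_p k"
    using less[of k] k by auto
  have "p ^ n * x i \<notin> (*) p ` B"
  proof
    assume "p ^ n * x i \<in> (*) p ` B"
    then obtain u where "u \<in> B" "p ^ n * x i = p * u"
      by blast
    then have "p ^ k * x i = u"
      using p_nonzero by (simp add: k mult.assoc)
    with \<open>u \<in> B\<close> i(2) B_sub_C show False
      by (auto simp: ball_p_def)
  qed
  with \<open>M < n\<close> n i show thesis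
    by (intro that[of n]) (auto simp: ball_p_def)
qed

lemma inverse_small:
  assumes "open V" "0 \<in> V"
  shows "\<exists>N. \<forall>x. x \<notin> ball_p N \<longrightarrow> inverse x \<in> V"
proof -
  define D where "D = C - (*) p ` B"
  have "compact D"
    unfolding D_def by (intro compact_diff compact_C open_times_left open_B p_nonzero)
  moreover have D0: "0 \<notin> D"
    using zero_B by (force simp: D_def)
  ultimately have "compact (inverse ` D)"
    by (intro compact_continuous_image continuous_intros) auto
  then obtain N where N: "\<And>n x. n \<ge> N \<Longrightarrow> x \<in> inverse ` D \<Longrightarrow> p ^ n * x \<in> V"
    using compact_absorbed[OF _ assms] by metis
  have "inverse x \<in> V" if x: "x \<notin> ball_p N" for x
  proof -
    obtain n where n: "n > N" "p ^ n * x \<in> C" "p ^ n * x \<notin> (*) p ` B"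
      using sphere_entry[of "{()}" "\<lambda>_. x" N] x by auto
    then have "p ^ n * inverse (p ^ n * x) \<in> V"
      by (intro N imageI) (auto simp: D_def)
    then show ?thesis
      using p_nonzero by (simp add: mult.assoc[symmetric])
  qed
  then show ?thesis
    by blast
qed

lemma tendsto_power_times_bounded:
  assumes "compact K" "\<And>n. x n \<in> K"
  shows "(\<lambda>n. p ^ n * x n) \<longlonglongrightarrow> 0"
  using tendsto_zero_times_bounded[OF p_power assms] .

end

text \<open>The contracting element may be taken from any set accumulating at zero, in particular
  from a nondiscrete subfield.\<close>

lemma contraction_exists:
  fixes A :: "'a :: local_field set"
  assumes "0 islimpt A"
  obtains p C U where "p \<in> A" "contraction p C U"
  using exists_contraction[OF assms] unfolding contraction_def by metis

lemma zero_islimpt_UNIV: "(0 :: 'a :: local_field) islimpt UNIV"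
proof -
  have "\<not> open {0 :: 'a}"
  proof
    assume op: "open {0 :: 'a}"
    have "open {a :: 'a}" for a
    proof -
      have "{a} = (\<lambda>x. x - a) -` {0}"
        by auto
      also have "open \<dots>"
        by (intro open_vimage op continuous_intros)
      finally show ?thesis .
    qed
    then have "open S" for S :: "'a set"
      using open_UN[of S "\<lambda>a. {a}"] by simp
    then show False
      using nondiscrete by blast
  qed
  then show ?thesis
    by (simp add: islimpt_UNIV_iff)
qed

section \<open>Matrices and special linear groups\<close>

definition elem_mat :: "'n \<Rightarrow> 'n \<Rightarrow> 'a \<Rightarrow> 'a :: zero ^ 'n ^ 'n"
  where "elem_mat i j c = (\<chi> a b. if a = i \<and> b = j then c else 0)"

definition transvection :: "'n \<Rightarrow> 'n \<Rightarrow> 'a \<Rightarrow> 'a :: semiring_1 ^ 'n ^ 'n"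
  where "transvection i j c = mat 1 + elem_mat i j c"

lemma elem_mat_nth: "elem_mat i j c $ a $ b = (if a = i \<and> b = j then c else 0)"
  by (simp add: elem_mat_def)

lemma mat_nth: "mat c $ a $ b = (if a = b then c else 0)"
  by (simp add: mat_def)

lemma transvection_nth:
  "transvection i j c $ a $ b = (if a = b then 1 else 0) + (if a = i \<and> b = j then c else 0)"
  by (simp add: transvection_def elem_mat_nth mat_nth)

lemma transvection_zero: "transvection i j 0 = mat 1"
  by (simp add: vec_eq_iff transvection_nth mat_nth)

lemma matrix_mult_nth: "(A ** B) $ a $ b = (\<Sum>k\<in>UNIV. A $ a $ k * B $ k $ b)"
  by (simp add: matrix_matrix_mult_def)

lemma sandwich_elem_mat_nth:
  fixes A B :: "'a :: comm_semiring_1 ^ 'n ^ 'n"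
  shows "(A ** elem_mat i j c ** B) $ a $ b = A $ a $ i * c * B $ j $ b"
proof -
  have "(A ** elem_mat i j c) $ a $ k = (if k = j then A $ a $ i * c else 0)" for k
    by (simp add: matrix_mult_nth elem_mat_nth if_distrib[of "\<lambda>x. _ * x"] cong: if_cong)
  then show ?thesis
    by (subst matrix_mult_nth) (simp add: if_distrib[of "\<lambda>x. x * _"] cong: if_cong)
qed

lemma elem_mat_mult_nth:
  fixes A :: "'a :: comm_semiring_1 ^ 'n ^ 'n"
  shows "(A ** elem_mat i j c) $ a $ b = (if b = j then A $ a $ i * c else 0)"
    and "(elem_mat i j c ** A) $ a $ b = (if a = i then c * A $ j $ b else 0)"
  using sandwich_elem_mat_nth[of A i j c "mat 1" a b] sandwich_elem_mat_nth[of "mat 1" i j c A a b]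
  by (auto simp: mat_nth)

lemma matrix_add_rdistrib:
  fixes A B :: "'a :: comm_semiring_1 ^ 'n ^ 'm"
  shows "(A + B) ** C = A ** C + B ** C"
  by (simp add: vec_eq_iff matrix_mult_nth distrib_right sum.distrib)

lemma conj_transvection:
  fixes A B :: "'a :: comm_semiring_1 ^ 'n ^ 'n"
  assumes "A ** B = mat 1"
  shows "A ** transvection i j c ** B = mat 1 + A ** elem_mat i j c ** B"
  by (simp add: transvection_def matrix_add_ldistrib matrix_add_rdistrib assms)

lemma transvection_mult_uminus:
  fixes c :: "'a :: comm_ring_1" and i j :: "'n :: finite"
  assumes "i \<noteq> j"
  shows "transvection i j c ** transvection i j (- c) = mat 1"
proof -
  have "elem_mat i j c ** elem_mat i j (- c) = (0 :: 'a ^ 'n ^ 'n)"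
    using assms by (simp add: vec_eq_iff elem_mat_mult_nth elem_mat_nth)
  moreover have "elem_mat i j c + elem_mat i j (- c) = (0 :: 'a ^ 'n ^ 'n)"
    by (simp add: vec_eq_iff elem_mat_nth)
  ultimately show ?thesis
    by (simp add: transvection_def matrix_add_ldistrib matrix_add_rdistrib add.assoc[symmetric])
qed

lemma det_transvection:
  fixes c :: "'a :: field"
  assumes "i \<noteq> j"
  shows "det (transvection i j c :: 'a ^ 'n ^ 'n) = 1"
proof -
  have "transvection i j c = (\<chi> k. if k = i then row i (mat 1) + c *s row j (mat 1)
      else row k (mat 1 :: 'a ^ 'n ^ 'n))"
    using assms by (auto simp: vec_eq_iff transvection_nth mat_nth row_def)
  then show ?thesis
    by (simp add: det_row_operation[OF assms])
qed

text \<open>The conjugate is a quadratic polynomial in \<open>k\<close>: the linear coefficient is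
  the commutator of the elementary matrix with \<open>A\<close>, the quadratic one picks out the
  single entry \<open>A $ j $ i\<close>. This form is used for growing \<open>k\<close>.\<close>

lemma conj_by_transvection_nth:
  fixes A :: "'a :: comm_ring_1 ^ 'n ^ 'n"
  assumes "i \<noteq> j"
  shows "(transvection i j k ** A ** transvection i j (- k)) $ a $ b =
    A $ a $ b + k * ((if a = i then A $ j $ b else 0) - (if b = j then A $ a $ i else 0))
      - k * k * (if a = i \<and> b = j then A $ j $ i else 0)"
proof -
  have "transvection i j k ** A ** transvection i j (- k) = A + elem_mat i j k ** A
      + A ** elem_mat i j (- k) + elem_mat i j k ** A ** elem_mat i j (- k)"
    by (simp add: transvection_def matrix_add_ldistrib matrix_add_rdistrib add.assoc add.left_commute)
  then show ?thesis
    by (simp add: elem_mat_mult_nth algebra_simps)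
qed

text \<open>Comparing suitable entries of the two products shows that off-diagonal entries vanish
  and that any two diagonal entries agree.\<close>

lemma commutes_elem_mat_imp_scalar:
  fixes A :: "'a :: comm_semiring_1 ^ 'n ^ 'n"
  assumes "\<And>i j. i \<noteq> j \<Longrightarrow> A ** elem_mat i j 1 = elem_mat i j 1 ** A"
  shows "A = mat (A $ k $ k)"
proof -
  have eq: "(if b = j then A $ a $ i else 0) = (if a = i then A $ j $ b else 0)" if "i \<noteq> j" for i j a b
    using arg_cong[OF assms[OF that], of "\<lambda>B. B $ a $ b"] by (simp only: elem_mat_mult_nth mult_1_right mult_1_left)
  have "A $ a $ b = 0" if "a \<noteq> b" for a b
    using eq[of b a a a] that by simp
  moreover have "A $ a $ a = A $ k $ k" for a
    using eq[of a k k a] by (cases "a = k") auto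
  ultimately show ?thesis
    by (auto simp: vec_eq_iff mat_nth)
qed

lemma mat_mult_nth:
  fixes A :: "'a :: comm_semiring_1 ^ 'n ^ 'n"
  shows "(mat z ** A) $ a $ b = z * A $ a $ b" "(A ** mat z) $ a $ b = z * A $ a $ b"
  by (simp_all add: matrix_mult_nth mat_nth if_distrib[of "\<lambda>x. _ * x"] if_distrib[of "\<lambda>x. x * _"]
      mult.commute cong: if_cong)

lemma mat_mult_commute:
  fixes A :: "'a :: comm_semiring_1 ^ 'n ^ 'n"
  shows "mat z ** A = A ** mat z"
  by (simp add: vec_eq_iff mat_mult_nth)

text \<open>Cramer's form: column \<open>k\<close> is replaced by the \<open>l\<close>-th unit
  vector. The entries are polynomial in those of \<open>A\<close>, so inversion on determinant one
  matrices is continuous and preserves subrings.\<close>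

definition adjugate :: "'a :: comm_ring_1 ^ 'n ^ 'n \<Rightarrow> 'a ^ 'n ^ 'n"
  where "adjugate A = (\<chi> k l. det (\<chi> i j. if j = k then (if i = l then 1 else 0) else A $ i $ j))"

text \<open>By Cramer's rule column \<open>l\<close> of the adjugate solves the linear system with
  the \<open>l\<close>-th unit vector as right-hand side; a right inverse of a square matrix is also
  a left inverse.\<close>

lemma mult_adjugate:
  fixes A :: "'a :: field ^ 'n ^ 'n"
  assumes "det A = 1"
  shows "A ** adjugate A = mat 1" "adjugate A ** A = mat 1"
proof -
  have "(A ** adjugate A) $ a $ l = mat 1 $ a $ l" for a l
  proof -
    have "(\<chi> k. adjugate A $ k $ l)
        = (\<chi> k. det (\<chi> i j. if j = k then (\<chi> i. if i = l then 1 else 0) $ i else A $ i $ j) / det A)"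
      unfolding adjugate_def assms vec_lambda_beta by simp
    then have "A *v (\<chi> k. adjugate A $ k $ l) = (\<chi> i. if i = l then 1 else 0)"
      by (subst cramer) (use assms in simp_all)
    then have "(A *v (\<chi> k. adjugate A $ k $ l)) $ a = (if a = l then 1 else 0)"
      by simp
    then show ?thesis
      by (simp add: matrix_vector_mult_def matrix_mult_nth mat_nth)
  qed
  then show "A ** adjugate A = mat 1"
    by (simp add: vec_eq_iff)
  then show "adjugate A ** A = mat 1"
    by (simp add: matrix_left_right_inverse)
qed

lemma adjugate_unique:
  fixes A :: "'a :: field ^ 'n ^ 'n"
  assumes "det A = 1" "A ** B = mat 1"
  shows "adjugate A = B"
  by (metis assms matrix_mul_assoc matrix_mul_lid matrix_mul_rid mult_adjugate(2))

lemma det_adjugate: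
  fixes A :: "'a :: field ^ 'n ^ 'n"
  assumes "det A = 1"
  shows "det (adjugate A) = 1"
  using arg_cong[OF mult_adjugate(1)[OF assms], of det] by (simp add: det_mul assms)

lemma adjugate_adjugate:
  fixes A :: "'a :: field ^ 'n ^ 'n"
  assumes "det A = 1"
  shows "adjugate (adjugate A) = A"
  using assms by (intro adjugate_unique det_adjugate mult_adjugate)

lemma adjugate_mult:
  fixes A B :: "'a :: field ^ 'n ^ 'n"
  assumes "det A = 1" "det B = 1"
  shows "adjugate (A ** B) = adjugate B ** adjugate A"
proof (rule adjugate_unique)
  show "A ** B ** (adjugate B ** adjugate A) = mat 1"
    by (metis assms matrix_mul_assoc matrix_mul_rid mult_adjugate(1))
qed (simp add: det_mul assms)

lemma adjugate_transvection:
  fixes c :: "'a :: field"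
  assumes "i \<noteq> j"
  shows "adjugate (transvection i j c :: 'a ^ 'n ^ 'n) = transvection i j (- c)"
  by (intro adjugate_unique det_transvection transvection_mult_uminus assms)

section \<open>Continuity of the matrix operations\<close>

lemma continuous_on_matrix_mult [continuous_intros]:
  fixes f g :: "'b :: topological_space \<Rightarrow> 'a :: local_field ^ 'n ^ 'n"
  assumes "continuous_on S f" "continuous_on S g"
  shows "continuous_on S (\<lambda>x. f x ** g x)"
  unfolding matrix_matrix_mult_def by (intro continuous_intros assms)

lemma continuous_on_matrix_add [continuous_intros]:
  fixes f g :: "'b :: topological_space \<Rightarrow> 'a :: local_field ^ 'n ^ 'n"
  assumes "continuous_on S f" "continuous_on S g"
  shows "continuous_on S (\<lambda>x. f x + g x)"
proof -
  have "(\<lambda>x. f x + g x) = (\<lambda>x. \<chi> i j. f x $ i $ j + g x $ i $ j)"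
    by (simp add: fun_eq_iff vec_eq_iff)
  then show ?thesis
    by (simp only:) (intro continuous_intros assms)
qed

lemma tendsto_matrix_mult [tendsto_intros]:
  fixes f g :: "'b \<Rightarrow> 'a :: local_field ^ 'n ^ 'n"
  assumes "(f \<longlongrightarrow> A) G" "(g \<longlongrightarrow> B) G"
  shows "((\<lambda>x. f x ** g x) \<longlongrightarrow> A ** B) G"
  unfolding matrix_matrix_mult_def by (intro tendsto_intros assms)

lemma tendsto_matrix_iff:
  fixes f :: "'b \<Rightarrow> 'a :: topological_space ^ 'n ^ 'm"
  shows "(f \<longlongrightarrow> A) G \<longleftrightarrow> (\<forall>i j. ((\<lambda>x. f x $ i $ j) \<longlongrightarrow> A $ i $ j) G)"
proof
  assume "(f \<longlongrightarrow> A) G"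
  then show "\<forall>i j. ((\<lambda>x. f x $ i $ j) \<longlongrightarrow> A $ i $ j) G"
    by (intro allI tendsto_vec_nth)
next
  assume "\<forall>i j. ((\<lambda>x. f x $ i $ j) \<longlongrightarrow> A $ i $ j) G"
  then have "((\<lambda>x. \<chi> i j. f x $ i $ j) \<longlongrightarrow> (\<chi> i j. A $ i $ j)) G"
    by (intro tendsto_vec_lambda) auto
  then show "(f \<longlongrightarrow> A) G"
    by simp
qed

lemma tendsto_det [tendsto_intros]:
  fixes f :: "'b \<Rightarrow> 'a :: local_field ^ 'n ^ 'n"
  assumes "(f \<longlongrightarrow> A) G"
  shows "((\<lambda>x. det (f x)) \<longlongrightarrow> det A) G"
  unfolding det_def by (intro tendsto_intros assms)

lemma tendsto_transvection:
  fixes f :: "'b \<Rightarrow> 'a :: local_field"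
  assumes "(f \<longlongrightarrow> c) G"
  shows "((\<lambda>x. transvection i j (f x)) \<longlongrightarrow> transvection i j c) G"
proof -
  have "((\<lambda>x. transvection i j (f x) $ a $ b) \<longlongrightarrow> transvection i j c $ a $ b) G" for a b
    unfolding transvection_nth by (cases "a = i \<and> b = j") (auto intro!: tendsto_intros assms)
  then show ?thesis
    by (simp add: tendsto_matrix_iff)
qed

lemma continuous_on_det [continuous_intros]:
  fixes f :: "'b :: topological_space \<Rightarrow> 'a :: local_field ^ 'n ^ 'n"
  assumes "continuous_on S f"
  shows "continuous_on S (\<lambda>x. det (f x))"
  unfolding det_def by (intro continuous_intros assms)

lemma continuous_on_adjugate [continuous_intros]:
  fixes f :: "'b :: topological_space \<Rightarrow> 'a :: local_field ^ 'n ^ 'n"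
  assumes "continuous_on S f"
  shows "continuous_on S (\<lambda>x. adjugate (f x))"
proof -
  have "continuous_on S (\<lambda>x. if j = k then c else f x $ i $ j)" for i j k c
    by (cases "j = k") (auto intro!: continuous_intros assms)
  then show ?thesis
    unfolding adjugate_def by (intro continuous_intros)
qed

section \<open>Special linear groups over subrings of a field\<close>

locale field_subring =
  fixes F :: "'a :: field set"
  assumes zero: "0 \<in> F" and one: "1 \<in> F"
    and add: "x \<in> F \<Longrightarrow> y \<in> F \<Longrightarrow> x + y \<in> F"
    and mult: "x \<in> F \<Longrightarrow> y \<in> F \<Longrightarrow> x * y \<in> F"
    and uminus: "x \<in> F \<Longrightarrow> - x \<in> F"
begin

lemma sum_closed: "(\<And>i. i \<in> I \<Longrightarrow> f i \<in> F) \<Longrightarrow> sum f I \<in> F"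
  by (induction I rule: infinite_finite_induct) (auto simp: zero add)

lemma prod_closed: "(\<And>i. i \<in> I \<Longrightarrow> f i \<in> F) \<Longrightarrow> prod f I \<in> F"
  by (induction I rule: infinite_finite_induct) (auto simp: one mult)

lemma power_closed: "x \<in> F \<Longrightarrow> x ^ n \<in> F"
  by (induction n) (auto simp: one mult)

lemma diff_closed: "x \<in> F \<Longrightarrow> y \<in> F \<Longrightarrow> x - y \<in> F"
  using add[OF _ uminus, of x y] by simp

lemma det_closed:
  fixes A :: "'a ^ 'n ^ 'n"
  assumes "\<And>i j. A $ i $ j \<in> F"
  shows "det A \<in> F"
proof -
  have "of_int (sign p) \<in> F" for p :: "'n \<Rightarrow> 'n"
    by (auto simp: sign_def one uminus)
  then show ?thesis
    unfolding det_def by (intro sum_closed mult prod_closed assms)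
qed

lemma SL_iff: "(A :: 'a ^ 'n ^ 'n) \<in> carrier (SL F) \<longleftrightarrow> (\<forall>i j. A $ i $ j \<in> F) \<and> det A = 1"
  by (simp add: SL_def)

lemma SL_one: "mat 1 \<in> carrier (SL F)"
  by (simp add: SL_iff mat_nth zero one)

lemma SL_mult: "A \<in> carrier (SL F) \<Longrightarrow> B \<in> carrier (SL F) \<Longrightarrow> A ** B \<in> carrier (SL F)"
  by (auto simp: SL_iff det_mul matrix_mult_nth intro!: sum_closed mult)

lemma SL_adjugate: "A \<in> carrier (SL F) \<Longrightarrow> adjugate A \<in> carrier (SL F)"
  by (auto simp: SL_iff det_adjugate) (auto simp: adjugate_def zero one intro!: det_closed)

lemma SL_transvection:
  assumes "c \<in> F" "i \<noteq> j"
  shows "transvection i j c \<in> carrier (SL F)"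
  using assms by (auto simp: SL_iff det_transvection transvection_nth zero one intro!: add)

lemma group_SL: "group (SL F :: ('a ^ 'n ^ 'n) monoid)"
proof (rule groupI)
  fix x y z :: "'a ^ 'n ^ 'n"
  assume "x \<in> carrier (SL F)"
  then show "\<exists>y\<in>carrier (SL F). y \<otimes>\<^bsub>SL F\<^esub> x = \<one>\<^bsub>SL F\<^esub>"
    using SL_adjugate[of x] mult_adjugate(2)[of x] by (intro bexI[of _ "adjugate x"]) (auto simp: SL_def)
qed (use SL_mult SL_one in \<open>auto simp: SL_def matrix_mul_assoc\<close>)

lemma inv_SL: "A \<in> carrier (SL F) \<Longrightarrow> inv\<^bsub>SL F\<^esub> A = adjugate A"
  using group.inv_equality[OF group_SL, of "adjugate A" A] SL_adjugate[of A] mult_adjugate(2)[of A]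
  by (auto simp: SL_def)

lemma mult_SL: "mult (SL F) = (**)"
  by (simp add: SL_def)

lemma center_scalar:
  fixes A :: "'a ^ 'n ^ 'n"
  assumes "A \<in> group_center (SL F)"
  shows "A = mat (A $ k $ k)"
proof (rule commutes_elem_mat_imp_scalar)
  fix i j :: 'n assume "i \<noteq> j"
  then have "A ** transvection i j 1 = transvection i j 1 ** A"
    using assms SL_transvection[OF one \<open>i \<noteq> j\<close>] by (auto simp: group_center_def mult_SL)
  then show "A ** elem_mat i j 1 = elem_mat i j 1 ** A"
    by (simp add: transvection_def matrix_add_ldistrib matrix_add_rdistrib)
qed

lemma scalar_in_center: "(mat z :: 'a ^ 'n ^ 'n) \<in> carrier (SL F) \<Longrightarrow>
    (mat z :: 'a ^ 'n ^ 'n) \<in> group_center (SL F)"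
  by (simp add: group_center_def mult_SL mat_mult_commute)

end

text \<open>A continuous binary operation preserving \<open>F\<close> maps the closure of
  \<open>F \<times> F\<close>, which is the square of the closure, into the closure of
  \<open>F\<close>.\<close>

lemma closure_field_subring:
  fixes F :: "'a :: local_field set"
  assumes "field_subring F"
  shows "field_subring (closure F)"
proof -
  interpret field_subring F by fact
  have sub: "(\<lambda>p. f (fst p) (snd p)) ` closure (F \<times> F) \<subseteq> closure F"
    if "continuous_on UNIV (\<lambda>p :: 'a \<times> 'a. f (fst p) (snd p))" "\<And>x y. x \<in> F \<Longrightarrow> y \<in> F \<Longrightarrow> f x y \<in> F"
    for f :: "'a \<Rightarrow> 'a \<Rightarrow> 'a"
    using that closure_subset[of F]
    by (intro image_closure_subset continuous_on_subset[OF that(1)]) auto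
  have sub': "f x y \<in> closure F" if "x \<in> closure F" "y \<in> closure F"
    "continuous_on UNIV (\<lambda>p :: 'a \<times> 'a. f (fst p) (snd p))" "\<And>x y. x \<in> F \<Longrightarrow> y \<in> F \<Longrightarrow> f x y \<in> F"
    for f x y
    using sub[of f] that unfolding closure_Times by force
  show ?thesis
  proof
    show "0 \<in> closure F" "1 \<in> closure F"
      using zero one closure_subset by auto
    show "x + y \<in> closure F" "x * y \<in> closure F" if "x \<in> closure F" "y \<in> closure F" for x y
      by (rule sub'[OF that]; auto intro!: continuous_intros add mult)+
    \<comment> \<open>Negation is treated as a binary operation that ignores its second
      argument.\<close>
    show "- x \<in> closure F" if "x \<in> closure F" for x
      by (rule sub'[OF that that, of "\<lambda>x y. - x"]; auto intro!: continuous_intros uminus)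
  qed
qed

section \<open>Coarser group topologies\<close>

text \<open>If an entry of \<open>g\<close> is large, boundedness of the products forces all entries of the inverse
  to be small, against determinant one.  The products with \<open>i = j\<close> are recovered by composing the
  conjugates of two opposite elementary matrices.\<close>

lemma (in contraction) bounded_if_conjugates_bounded:
  fixes K :: "'a set"
  assumes K: "compact K"
  shows "\<exists>N. \<forall>g :: 'a ^ 'n ^ 'n. det g = 1 \<longrightarrow>
    (\<forall>i j a b. i \<noteq> j \<longrightarrow> g $ a $ i * adjugate g $ j $ b \<in> K) \<longrightarrow> (\<forall>a b. g $ a $ b \<in> ball_p N)"
proof (rule ccontr)
  define V where "V = {v :: 'a ^ 'n. \<forall>i. v $ i \<in> K}"
  \<comment> \<open>The inner products of vectors over \<open>K\<close> account for the diagonal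
    case \<open>i = j\<close>; the extra element 1 accounts for matrices of size one, where no other
    index exists.\<close>
  define K' where "K' = insert 1 (K \<union> (\<lambda>p. \<Sum>k\<in>UNIV. fst p $ k * snd p $ k) ` (V \<times> V))"
  have "compact ((\<lambda>p :: ('a ^ 'n) \<times> ('a ^ 'n). \<Sum>k\<in>UNIV. fst p $ k * snd p $ k) ` (V \<times> V))"
    unfolding V_def by (intro compact_continuous_image continuous_intros compact_Times
        compact_vec_pointwise K)
  then have K': "compact K'"
    unfolding K'_def by (intro compact_insert compact_Un K)
  have all: "g $ a $ i * adjugate g $ j $ b \<in> K'"
    if g: "det g = 1" "\<forall>i j a b. i \<noteq> j \<longrightarrow> g $ a $ i * adjugate g $ j $ b \<in> K"
    for g :: "'a ^ 'n ^ 'n" and i j a b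
  proof (cases "i = j")
    case False
    then show ?thesis
      using g by (simp add: K'_def)
  next
    case [simp]: True
    show ?thesis
    proof (cases "\<exists>k. k \<noteq> i")
      case True
      then obtain k where k: "k \<noteq> i"
        by blast
      \<comment> \<open>\<open>v\<close> is row \<open>a\<close> of the conjugate of the elementary
        matrix at \<open>(i, k)\<close>, and \<open>w\<close> is column \<open>b\<close> of the
        conjugate of the one at \<open>(k, i)\<close>. Inserting a diagonal entry of the product
        \<open>adjugate g ** g\<close>, which is 1, makes the wanted product their inner
        product.\<close>
      define v :: "'a ^ 'n" where "v = (\<chi> l. g $ a $ i * adjugate g $ k $ l)"
      define w :: "'a ^ 'n" where "w = (\<chi> l. g $ l $ k * adjugate g $ i $ b)"
      have "(\<Sum>l\<in>UNIV. adjugate g $ k $ l * g $ l $ k) = 1"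
        using arg_cong[OF mult_adjugate(2)[OF g(1)], of "\<lambda>A. A $ k $ k"]
        by (simp add: matrix_mult_nth mat_nth)
      then have "g $ a $ i * adjugate g $ i $ b =
          g $ a $ i * (\<Sum>l\<in>UNIV. adjugate g $ k $ l * g $ l $ k) * adjugate g $ i $ b"
        by simp
      also have "\<dots> = (\<Sum>l\<in>UNIV. v $ l * w $ l)"
        by (simp add: v_def w_def sum_distrib_left sum_distrib_right ac_simps)
      finally have "g $ a $ i * adjugate g $ i $ b = (\<Sum>l\<in>UNIV. fst (v, w) $ l * snd (v, w) $ l)"
        by simp
      moreover have "(v, w) \<in> V \<times> V"
        using g(2) k by (auto simp: V_def v_def w_def)
      ultimately show ?thesis
        unfolding K'_def \<open>i = j\<close>[symmetric] by blast
    next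
      case False
      then have U: "UNIV = {i}" and "a = i" "b = i"
        by auto
      then show ?thesis
        using arg_cong[OF mult_adjugate(1)[OF g(1)], of "\<lambda>A. A $ i $ i"]
        by (simp add: matrix_mult_nth mat_nth U K'_def)
    qed
  qed
  assume "\<not> ?thesis"
  then have "\<exists>g :: 'a ^ 'n ^ 'n. det g = 1 \<and>
    (\<forall>i j a b. i \<noteq> j \<longrightarrow> g $ a $ i * adjugate g $ j $ b \<in> K) \<and> (\<exists>a b. g $ a $ b \<notin> ball_p N)" for N
    by (simp only: not_ex not_all not_imp)
  then obtain g :: "nat \<Rightarrow> 'a ^ 'n ^ 'n" where g: "\<And>N. det (g N) = 1"
      "\<And>N. \<forall>i j a b. i \<noteq> j \<longrightarrow> g N $ a $ i * adjugate (g N) $ j $ b \<in> K"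
      "\<And>N. \<exists>a b. g N $ a $ b \<notin> ball_p N"
    by metis
  obtain a b where ab: "\<And>N. g N $ a N $ b N \<notin> ball_p N"
    using g(3) by metis
  define x where "x N = g N $ a N $ b N" for N
  have x: "x N \<notin> ball_p N" for N
    using ab by (simp add: x_def)
  have lim0: "(\<lambda>N. inverse (x N)) \<longlonglongrightarrow> 0"
  proof (rule topological_tendstoI)
    fix S :: "'a set" assume "open S" "0 \<in> S"
    then obtain N0 where N0: "\<And>y. y \<notin> ball_p N0 \<Longrightarrow> inverse y \<in> S"
      using inverse_small by blast
    have "inverse (x N) \<in> S" if "N \<ge> N0" for N
      using N0 x[of N] ball_p_mono[OF that] by blast
    then show "eventually (\<lambda>N. inverse (x N) \<in> S) sequentially"
      by (auto simp: eventually_sequentially)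
  qed
  have "(\<lambda>N. adjugate (g N) $ k $ l) \<longlonglongrightarrow> 0" for k l
  proof -
    have "x N * adjugate (g N) $ k $ l \<in> K'" for N
      using all[OF g(1,2)] by (simp add: x_def)
    then have "(\<lambda>N. inverse (x N) * (x N * adjugate (g N) $ k $ l)) \<longlonglongrightarrow> 0"
      by (rule tendsto_zero_times_bounded[OF lim0 K'])
    \<comment> \<open>Cancelling \<open>x N\<close> is legitimate only once the ball that
      \<open>x N\<close> avoids contains zero.\<close>
    moreover have "x N \<noteq> 0" if "N \<ge> N1" "0 \<in> ball_p N1" for N N1
      using x[of N] ball_p_mono[OF that(1)] that(2) by auto
    moreover obtain N1 where "0 \<in> ball_p N1"
      using compact_sub_ball_p[of "{0}"] by auto
    ultimately show ?thesis
      by (elim Lim_transform_eventually)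
        (auto simp: eventually_sequentially mult.assoc[symmetric] intro!: exI[of _ N1])
  qed
  then have "(\<lambda>N. adjugate (g N)) \<longlonglongrightarrow> mat 0"
    by (simp add: tendsto_matrix_iff mat_nth)
  from tendsto_det[OF this] have "(\<lambda>N. det (adjugate (g N))) \<longlonglongrightarrow> 0"
    unfolding det_0 .
  then show False
    using LIMSEQ_unique[of "\<lambda>N. 1 :: 'a" 1 0] by (simp add: det_adjugate g(1))
qed

text \<open>These are the identity neighbourhoods of a coarser Hausdorff group topology, seen inside
  the matrix space. In \<open>NB_sep\<close> the closure is taken among all matrices, not in the
  coarser topology.\<close>

locale coarse_nbhds = field_subring F for F :: "'p :: local_field set" +
  fixes NB :: "('p ^ 'n ^ 'n) set set"
  assumes NB_open: "U \<in> NB \<Longrightarrow> \<exists>V. open V \<and> U = V \<inter> carrier (SL F)"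
    and NB_one: "U \<in> NB \<Longrightarrow> mat 1 \<in> U"
    and NB_nonempty: "NB \<noteq> {}"
    and NB_Int: "U \<in> NB \<Longrightarrow> V \<in> NB \<Longrightarrow> U \<inter> V \<in> NB"
    and NB_div: "U \<in> NB \<Longrightarrow> \<exists>W\<in>NB. \<forall>x\<in>W. \<forall>y\<in>W. x ** adjugate y \<in> U"
    and NB_conj: "U \<in> NB \<Longrightarrow> g \<in> carrier (SL F) \<Longrightarrow> \<exists>W\<in>NB. \<forall>x\<in>W. g ** x ** adjugate g \<in> U"
    and NB_sep: "x \<in> carrier (SL F) \<Longrightarrow> x \<noteq> mat 1 \<Longrightarrow> \<exists>U\<in>NB. x \<notin> closure U"
begin

lemma NB_sub: "U \<in> NB \<Longrightarrow> U \<subseteq> carrier (SL F)"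
  using NB_open by blast

lemma NB_Inter: "finite M \<Longrightarrow> M \<noteq> {} \<Longrightarrow> M \<subseteq> NB \<Longrightarrow> \<Inter>M \<in> NB"
  by (induction M rule: finite_ne_induct) (auto simp: NB_Int)

text \<open>The kernel of the extension of the identity from the closure of \<open>SL F\<close> to the completion
  of the coarser group.\<close>

definition core :: "('p ^ 'n ^ 'n) set"
  where "core = (\<Inter>U\<in>NB. closure U)"

lemma closed_core: "closed core"
  unfolding core_def by auto

lemma one_core: "mat 1 \<in> core"
  using NB_one closure_subset by (fastforce simp: core_def)

lemma core_Int_SL: "core \<inter> carrier (SL F) = {mat 1}"
  using one_core SL_one NB_sep by (auto simp: core_def)

text \<open>Finite intersection property in \<open>Q\<close>: the family \<open>NB\<close> is closed
  under finite intersections, so finitely many closures always share a point of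
  \<open>Q\<close>.\<close>

lemma core_meets:
  assumes Q: "compact Q" and meets: "\<And>U. U \<in> NB \<Longrightarrow> U \<inter> Q \<noteq> {}"
  shows "core \<inter> Q \<noteq> {}"
proof -
  have "Q \<inter> \<Inter>(closure ` NB) \<noteq> {}"
  proof (rule compact_imp_fip[OF Q])
    fix M assume "finite M" "M \<subseteq> closure ` NB"
    then obtain M' where M': "M' \<subseteq> NB" "finite M'" "M = closure ` M'"
      by (meson finite_subset_image)
    obtain U0 where "U0 \<in> NB"
      using NB_nonempty by blast
    \<comment> \<open>\<open>U0\<close> is added because \<open>M'\<close> may be empty.\<close>
    then have "\<Inter>(insert U0 M') \<in> NB"
      using M' by (intro NB_Inter) auto
    then obtain x where "x \<in> \<Inter>(insert U0 M')" "x \<in> Q"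
      using meets by blast
    then have "x \<in> Q \<inter> \<Inter>M"
      using M'(3) closure_subset by fastforce
    then show "Q \<inter> \<Inter>M \<noteq> {}"
      by blast
  qed auto
  then show ?thesis
    by (auto simp: core_def)
qed

text \<open>Continuity carries an estimate on \<open>W \<times> W\<close> over to its closure, with
  values in the closure of \<open>U\<close>; letting \<open>U\<close> vary gives the claim.\<close>

lemma core_closed_under:
  assumes cont: "continuous_on UNIV (\<lambda>q :: ('p ^ 'n ^ 'n) \<times> ('p ^ 'n ^ 'n). f (fst q) (snd q))"
    and NB: "\<And>U. U \<in> NB \<Longrightarrow> \<exists>W\<in>NB. \<forall>x\<in>W. \<forall>y\<in>W. f x y \<in> U"
    and xy: "x \<in> core" "y \<in> core"
  shows "f x y \<in> core"
  unfolding core_def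
proof
  fix U assume "U \<in> NB"
  then obtain W where W: "W \<in> NB" "\<forall>x\<in>W. \<forall>y\<in>W. f x y \<in> U"
    using NB by blast
  have "(\<lambda>q. f (fst q) (snd q)) ` closure (W \<times> W) \<subseteq> closure U"
    using W closure_subset[of U]
    by (intro image_closure_subset continuous_on_subset[OF cont]) auto
  moreover have "(x, y) \<in> closure (W \<times> W)"
    using W(1) xy by (simp add: closure_Times core_def)
  ultimately show "f x y \<in> closure U"
    by force
qed

lemma core_div: "x \<in> core \<Longrightarrow> y \<in> core \<Longrightarrow> x ** adjugate y \<in> core"
  by (rule core_closed_under[of "\<lambda>x y. x ** adjugate y"])
    (auto intro!: continuous_intros NB_div)

lemma core_conj: "g \<in> carrier (SL F) \<Longrightarrow> x \<in> core \<Longrightarrow> g ** x ** adjugate g \<in> core"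
  \<comment> \<open>Conjugation by a fixed \<open>g\<close> is a binary operation with a dummy
    second argument.\<close>
  using core_closed_under[of "\<lambda>x y. g ** x ** adjugate g" x x] NB_conj[of _ g]
  by (fastforce intro!: continuous_intros)

lemma core_sub: "core \<subseteq> carrier (SL (closure F))"
proof -
  obtain U where U: "U \<in> NB"
    using NB_nonempty by blast
  let ?S = "{A :: 'p ^ 'n ^ 'n. (\<forall>i j. A $ i $ j \<in> closure F) \<and> det A = 1}"
  have "closed {A :: 'p ^ 'n ^ 'n. A $ i $ j \<in> closure F}" for i j
  proof -
    have "continuous_on UNIV (\<lambda>A :: 'p ^ 'n ^ 'n. A $ i $ j)"
      by (intro continuous_on_component continuous_on_id)
    from closed_vimage[OF closed_closure this] show ?thesis
      by (simp add: vimage_def)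
  qed
  moreover have "closed {A :: 'p ^ 'n ^ 'n. det A = 1}"
    by (intro closed_Collect_eq continuous_intros)
  ultimately have "closed ?S"
    by (intro closed_Collect_conj closed_Collect_all) auto
  moreover have "U \<subseteq> ?S"
    using subsetD[OF NB_sub[OF U]] subsetD[OF closure_subset[of F]] by (auto simp: SL_def)
  ultimately have "closure U \<subseteq> ?S"
    by (simp add: closure_minimal)
  then show ?thesis
    using U by (auto simp: core_def SL_def)
qed

lemma det_core: "x \<in> core \<Longrightarrow> det x = 1"
  using core_sub by (auto simp: SL_def)

lemma det_NB: "U \<in> NB \<Longrightarrow> x \<in> U \<Longrightarrow> det x = 1"
  using NB_sub by (auto simp: SL_def)

lemma core_mult:
  assumes "x \<in> core" "y \<in> core"
  shows "x ** y \<in> core"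
proof -
  have "adjugate y \<in> core"
    using core_div[OF one_core assms(2)] by simp
  from core_div[OF assms(1) this] show ?thesis
    by (simp add: adjugate_adjugate det_core assms)
qed

text \<open>In contrast to \<open>NB_conj\<close>, the conjugating element varies together with the
  conjugated one. Three successive divisions suffice: invert \<open>s\<close>, form
  \<open>g ** s\<close>, divide by \<open>g\<close>.\<close>

lemma NB_conj':
  assumes "U \<in> NB"
  shows "\<exists>W\<in>NB. \<forall>g\<in>W. \<forall>s\<in>W. g ** s ** adjugate g \<in> U"
proof -
  obtain W1 where W1: "W1 \<in> NB" "\<forall>x\<in>W1. \<forall>y\<in>W1. x ** adjugate y \<in> U"
    using NB_div[OF assms] by blast
  obtain W2 where W2: "W2 \<in> NB" "\<forall>x\<in>W2. \<forall>y\<in>W2. x ** adjugate y \<in> W1"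
    using NB_div[OF W1(1)] by blast
  obtain W3 where W3: "W3 \<in> NB" "\<forall>x\<in>W3. \<forall>y\<in>W3. x ** adjugate y \<in> W2"
    using NB_div[OF W2(1)] by blast
  show ?thesis
  proof (intro bexI ballI)
    fix g s assume g: "g \<in> W1 \<inter> W2 \<inter> W3" and s: "s \<in> W1 \<inter> W2 \<inter> W3"
    have "adjugate s \<in> W2"
      using W3(2) NB_one[OF W3(1)] s by force
    then have "g ** adjugate (adjugate s) \<in> W1"
      using W2(2) g by blast
    then show "g ** s ** adjugate g \<in> U"
      using W1 g s det_NB by (auto simp: adjugate_adjugate)
  qed (use W1 W2 W3 NB_Int in auto)
qed

end

text \<open>The nondiscrete case: with the contracting element in \<open>F\<close>, the
  transvections by its positive and negative powers are available in \<open>SL F\<close>.\<close>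

locale contracted_nbhds = coarse_nbhds F NB + contraction p C B
  for F :: "'p :: local_field set" and NB :: "('p ^ 'n ^ 'n) set set" and p :: 'p and C B +
  assumes p_F: "p \<in> F" and inverse_F: "x \<in> F \<Longrightarrow> inverse x \<in> F"
begin

definition unbounded :: "('p ^ 'n ^ 'n) set \<Rightarrow> bool"
  where "unbounded S \<longleftrightarrow> (\<forall>N. \<exists>g\<in>S. \<exists>a b. g $ a $ b \<notin> ball_p N)"

lemma eventually_transvection_NB:
  assumes "U \<in> NB"
  shows "\<exists>M. \<forall>n\<ge>M. \<forall>i j. i \<noteq> j \<longrightarrow> transvection i j (p ^ n) \<in> U"
proof -
  obtain V where V: "open V" "U = V \<inter> carrier (SL F)"
    using NB_open[OF assms] by blast
  have "\<forall>\<^sub>F n in sequentially. transvection i j (p ^ n) \<in> V" for i j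
  proof -
    have "(\<lambda>n. transvection i j (p ^ n) :: 'p ^ 'n ^ 'n) \<longlonglongrightarrow> transvection i j 0"
      by (rule tendsto_transvection[OF p_power])
    moreover have "transvection i j 0 \<in> V"
      using NB_one[OF assms] V(2) by (auto simp: transvection_zero)
    ultimately show ?thesis
      using V(1) by (auto dest: topological_tendstoD)
  qed
  then have "\<forall>\<^sub>F n in sequentially. \<forall>i j. transvection i j (p ^ n) \<in> V"
    by (simp add: eventually_all_finite)
  then show ?thesis
    using V(2) SL_transvection power_closed[OF p_F] unfolding eventually_sequentially by blast
qed

text \<open>Conjugating a small transvection by a large element of a coarse neighbourhood and choosing
  the size of the transvection accordingly gives elements at bounded distance from the identity.\<close>

lemma core_unipotent:
  assumes unb: "\<And>U. U \<in> NB \<Longrightarrow> unbounded U"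
  obtains Y where "mat 1 + Y \<in> core" "Y \<noteq> 0" "Y ** Y = 0"
proof -
  define Q where "Q = {Y :: 'p ^ 'n ^ 'n. \<forall>a b. Y $ a $ b \<in> C} \<inter>
    ((\<Union>a. \<Union>b. (\<lambda>Y. Y $ a $ b) -` (- (*) p ` B)) \<inter> {Y. Y ** Y = 0})"
  have "closed ((\<lambda>Y :: 'p ^ 'n ^ 'n. Y $ a $ b) -` (- (*) p ` B))" for a b
    by (intro closed_vimage continuous_on_component continuous_on_id closed_Compl
        open_times_left open_B p_nonzero)
  then have "compact Q"
    unfolding Q_def
    by (intro compact_Int_closed compact_mat_pointwise compact_C closed_Int closed_UN
        closed_Collect_eq continuous_intros) auto
  then have "compact ((\<lambda>Y. mat 1 + Y) ` Q)"
    by (intro compact_continuous_image continuous_intros)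
  moreover have "U \<inter> (\<lambda>Y. mat 1 + Y) ` Q \<noteq> {}" if U: "U \<in> NB" for U
  proof -
    obtain W where W: "W \<in> NB" "\<And>g s. g \<in> W \<Longrightarrow> s \<in> W \<Longrightarrow> g ** s ** adjugate g \<in> U"
      using NB_conj'[OF U] by blast
    \<comment> \<open>The order of choices matters: \<open>M\<close> makes the transvections small
      enough for \<open>W\<close>, \<open>N\<close> is the entry bound belonging to products in
      \<open>ball_p M\<close>, and only then is \<open>g\<close> taken beyond \<open>N\<close>. Some
      product thus leaves \<open>ball_p M\<close>, so the scaling exponent \<open>n\<close> exceeds
      \<open>M\<close>.\<close>
    obtain M where M: "\<And>n i j. n \<ge> M \<Longrightarrow> i \<noteq> j \<Longrightarrow> transvection i j (p ^ n) \<in> W"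
      using eventually_transvection_NB[OF W(1)] by blast
    obtain N where N: "\<And>g :: 'p ^ 'n ^ 'n. det g = 1 \<Longrightarrow>
        \<forall>i j a b. i \<noteq> j \<longrightarrow> g $ a $ i * adjugate g $ j $ b \<in> ball_p M \<Longrightarrow> \<forall>a b. g $ a $ b \<in> ball_p N"
      using bounded_if_conjugates_bounded[OF compact_ball_p[of M]] by blast
    obtain g where g: "g \<in> W" "\<not> (\<forall>a b. g $ a $ b \<in> ball_p N)"
      using unb[OF W(1)] unfolding unbounded_def by blast
    have detg: "det g = 1"
      using det_NB[OF W(1) g(1)] .
    obtain i j where ij: "i \<noteq> j" "\<exists>q\<in>UNIV. g $ fst q $ i * adjugate g $ j $ snd q \<notin> ball_p M"
      using N[OF detg] g(2) by fastforce
    obtain n where n: "n > M" "\<And>q. q \<in> UNIV \<Longrightarrow> p ^ n * (g $ fst q $ i * adjugate g $ j $ snd q) \<in> C"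
        "\<exists>q\<in>UNIV. p ^ n * (g $ fst q $ i * adjugate g $ j $ snd q) \<notin> (*) p ` B"
      using sphere_entry[OF _ ij(2)] by auto
    define Y where "Y = g ** elem_mat i j (p ^ n) ** adjugate g"
    have Y: "Y $ a $ b = p ^ n * (g $ a $ i * adjugate g $ j $ b)" for a b
      by (simp add: Y_def sandwich_elem_mat_nth)
    have "Y ** Y = g ** elem_mat i j (p ^ n) ** (adjugate g ** g) ** elem_mat i j (p ^ n) ** adjugate g"
      by (simp add: Y_def matrix_mul_assoc)
    also have "\<dots> = g ** (elem_mat i j (p ^ n) ** elem_mat i j (p ^ n)) ** adjugate g"
      by (simp add: mult_adjugate detg matrix_mul_assoc)
    also have "elem_mat i j (p ^ n) ** elem_mat i j (p ^ n) = (0 :: 'p ^ 'n ^ 'n)"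
      using ij(1) by (simp add: vec_eq_iff elem_mat_mult_nth elem_mat_nth)
    finally have YY: "Y ** Y = 0"
      by (simp add: vec_eq_iff matrix_mult_nth)
    have "Y \<in> Q"
      using n(2)[of "(_, _)"] n(3) YY by (auto simp: Q_def Y)
    moreover have "mat 1 + Y \<in> U"
      using W(2)[OF g(1) M[of n i j]] n(1) ij(1)
      by (simp add: conj_transvection[OF mult_adjugate(1)[OF detg]] Y_def)
    ultimately show ?thesis
      by blast
  qed
  ultimately have "core \<inter> (\<lambda>Y. mat 1 + Y) ` Q \<noteq> {}"
    by (rule core_meets)
  then obtain Y where Y: "mat 1 + Y \<in> core" "Y \<in> Q"
    by blast
  moreover have "Y \<noteq> 0"
    using Y(2) zero_B by (force simp: Q_def)
  ultimately show thesis
    by (intro that) (auto simp: Q_def)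
qed

lemma inverse_closure:
  assumes "y \<in> closure F"
  shows "inverse y \<in> closure F"
proof (cases "y = 0")
  case True
  then show ?thesis
    using zero closure_subset by auto
next
  case False
  show ?thesis
  proof (rule ccontr)
    assume "inverse y \<notin> closure F"
    then have "eventually (\<lambda>x. inverse x \<in> - closure F) (nhds y)"
      by (intro topological_tendstoD[OF tendsto_inverse_nhds[OF False]]) auto
    then obtain S where S: "open S" "y \<in> S" "\<And>x. x \<in> S \<Longrightarrow> inverse x \<notin> closure F"
      unfolding eventually_nhds by auto
    then obtain x where "x \<in> S" "x \<in> F"
      using assms open_Int_closure_eq_empty[of S F] by auto
    then show False
      using S(3) inverse_F closure_subset by blast
  qed
qed

lemma power_two_zero: "(\<lambda>n. p ^ n * p ^ n) \<longlonglongrightarrow> 0"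
  using tendsto_mult[OF p_power p_power] by simp

lemma rescaled_conjugate:
  fixes q k y d e :: 'p
  assumes "q * k = 1"
  shows "(q * q) * (y + k * d - k * k * e) = (q * q) * y + q * d - e"
proof -
  have "(q * q) * (y + k * d - k * k * e) = (q * q) * y + (q * k) * q * d - (q * k) * (q * k) * e"
    by (simp add: algebra_simps)
  then show ?thesis
    by (simp add: assms)
qed

text \<open>Conjugating \<open>mat 1 + Y\<close> by an ever larger transvection and taking commutators with a suitably
  small opposite one, only the dominant terms survive in the limit.\<close>

lemma core_transvection:
  assumes core: "mat 1 + Y \<in> core" and YY: "Y ** Y = 0" and ij: "i \<noteq> j" and f: "f \<in> F"
  shows "transvection i j (- (f * (Y $ j $ i) * (Y $ j $ i))) \<in> core"
proof -
  define k where "k n = inverse (p ^ n)" for n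
  define T where "T n = transvection i j (k n) ** Y ** transvection i j (- k n)" for n
  \<comment> \<open>The parameter carries four factors \<open>p ^ n\<close>: both sides of the
    conjugation by \<open>mat 1 + T n\<close> grow at most like \<open>k n * k n\<close>, so the
    conjugate of \<open>s n\<close> converges although \<open>s n\<close> itself tends to the
    identity.\<close>
  define s where "s n = (transvection j i (f * (p ^ n * p ^ n) * (p ^ n * p ^ n)) :: 'p ^ 'n ^ 'n)" for n
  have k_F: "k n \<in> F" for n
    by (simp add: k_def inverse_F power_closed p_F)
  have pk: "p ^ n * k n = 1" for n
    using p_nonzero by (simp add: k_def)
  have T: "T n $ a $ b = Y $ a $ b + k n * ((if a = i then Y $ j $ b else 0) - (if b = j then Y $ a $ i else 0))
      - k n * k n * (if a = i \<and> b = j then Y $ j $ i else 0)" for n a b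
    by (simp add: T_def conj_by_transvection_nth[OF ij])
  have lim: "(\<lambda>n. (p ^ n * p ^ n) * T n $ a $ b) \<longlonglongrightarrow> - (if a = i \<and> b = j then Y $ j $ i else 0)" for a b
  proof -
    have "(p ^ n * p ^ n) * T n $ a $ b = (p ^ n * p ^ n) * Y $ a $ b
      + p ^ n * ((if a = i then Y $ j $ b else 0) - (if b = j then Y $ a $ i else 0))
      - (if a = i \<and> b = j then Y $ j $ i else 0)" for n
      unfolding T by (rule rescaled_conjugate[OF pk])
    moreover have "(\<lambda>n. (p ^ n * p ^ n) * Y $ a $ b
      + p ^ n * ((if a = i then Y $ j $ b else 0) - (if b = j then Y $ a $ i else 0))
      - (if a = i \<and> b = j then Y $ j $ i else 0)) \<longlonglongrightarrow>
      0 * Y $ a $ b + 0 * ((if a = i then Y $ j $ b else 0) - (if b = j then Y $ a $ i else 0))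
      - (if a = i \<and> b = j then Y $ j $ i else 0)"
      by (intro tendsto_intros p_power power_two_zero)
    ultimately show ?thesis
      by simp
  qed
  have lim1: "(\<lambda>n. (p ^ n * p ^ n) * (mat 1 $ a $ b + T n $ a $ b)) \<longlonglongrightarrow> - (if a = i \<and> b = j then Y $ j $ i else 0)"
    and lim2: "(\<lambda>n. (p ^ n * p ^ n) * (mat 1 $ a $ b - T n $ a $ b)) \<longlonglongrightarrow> (if a = i \<and> b = j then Y $ j $ i else 0)" for a b
    using tendsto_add[OF tendsto_mult_right[OF power_two_zero, of "mat 1 $ a $ b"] lim[of a b]]
      tendsto_diff[OF tendsto_mult_right[OF power_two_zero, of "mat 1 $ a $ b"] lim[of a b]]
    by (simp_all add: distrib_left right_diff_distrib)
  have tau: "transvection i j (k n) \<in> carrier (SL F)" for n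
    by (intro SL_transvection k_F ij)
  have g_core: "mat 1 + T n \<in> core" for n
  proof -
    have "transvection i j (k n) ** (mat 1 + Y) ** adjugate (transvection i j (k n)) = mat 1 + T n"
      by (simp add: adjugate_transvection[OF ij] T_def matrix_add_ldistrib matrix_add_rdistrib
          transvection_mult_uminus[OF ij])
    then show ?thesis
      using core_conj[OF tau core] by metis
  qed
  \<comment> \<open>\<open>T n\<close> is conjugate to \<open>Y\<close> and therefore also has
    square zero.\<close>
  have adj_g: "adjugate (mat 1 + T n) = mat 1 - T n" for n
  proof (rule adjugate_unique)
    have TT: "T n ** T n = 0"
    proof -
      have "T n ** T n = transvection i j (k n) ** Y **
          (transvection i j (- k n) ** transvection i j (- (- k n))) ** Y ** transvection i j (- k n)"
        by (simp add: T_def matrix_mul_assoc)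
      also have "\<dots> = transvection i j (k n) ** (Y ** Y) ** transvection i j (- k n)"
        unfolding transvection_mult_uminus[OF ij] by (simp add: matrix_mul_assoc)
      finally show ?thesis
        by (simp add: YY vec_eq_iff matrix_mult_nth)
    qed
    have "(mat 1 + T n) ** (mat 1 - T n) + (mat 1 + T n) ** T n = mat 1 + T n"
      by (simp add: matrix_add_ldistrib[symmetric])
    then show "(mat 1 + T n) ** (mat 1 - T n) = mat 1"
      by (simp add: matrix_add_rdistrib TT)
  qed (simp add: det_core g_core)
  have s_F: "s n \<in> carrier (SL F)" for n
    unfolding s_def using ij by (intro SL_transvection mult f power_closed p_F) auto
  \<comment> \<open>The conjugate is the identity plus a rescaled product of column \<open>j\<close>
    of \<open>mat 1 + T n\<close> with row \<open>i\<close> of \<open>mat 1 - T n\<close>. By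
    \<open>lim1\<close> and \<open>lim2\<close> only position \<open>(i, j)\<close> survives, with
    factors of opposite sign; this yields the minus sign and the square of
    \<open>Y $ j $ i\<close>.\<close>
  have "(\<lambda>n. (mat 1 + T n) ** s n ** adjugate (mat 1 + T n)) \<longlonglongrightarrow>
      transvection i j (- (f * (Y $ j $ i) * (Y $ j $ i)))"
    unfolding tendsto_matrix_iff
  proof (intro allI)
    fix a b
    have "((mat 1 + T n) ** s n ** adjugate (mat 1 + T n)) $ a $ b = mat 1 $ a $ b +
       f * ((p ^ n * p ^ n) * (mat 1 $ a $ j + T n $ a $ j)) * ((p ^ n * p ^ n) * (mat 1 $ i $ b - T n $ i $ b))"
      for n
      unfolding s_def conj_transvection[OF mult_adjugate(1)[OF det_core[OF g_core]]]
      by (simp add: sandwich_elem_mat_nth adj_g)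
    moreover have "(\<lambda>n. mat 1 $ a $ b + f * ((p ^ n * p ^ n) * (mat 1 $ a $ j + T n $ a $ j)) *
        ((p ^ n * p ^ n) * (mat 1 $ i $ b - T n $ i $ b))) \<longlonglongrightarrow>
      mat 1 $ a $ b + f * (- (if a = i \<and> j = j then Y $ j $ i else 0)) * (if i = i \<and> b = j then Y $ j $ i else 0)"
      by (intro tendsto_intros lim1 lim2)
    moreover have "mat 1 $ a $ b + f * (- (if a = i \<and> j = j then Y $ j $ i else 0)) *
        (if i = i \<and> b = j then Y $ j $ i else 0) = transvection i j (- (f * (Y $ j $ i) * (Y $ j $ i))) $ a $ b"
      by (simp add: transvection_nth mat_nth)
    ultimately show "(\<lambda>n. ((mat 1 + T n) ** s n ** adjugate (mat 1 + T n)) $ a $ b) \<longlonglongrightarrow>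
        transvection i j (- (f * (Y $ j $ i) * (Y $ j $ i))) $ a $ b"
      by (simp only:)
  qed
  moreover have "(\<lambda>n. adjugate (s n)) \<longlonglongrightarrow> mat 1"
  proof -
    have "(\<lambda>n. transvection j i (- (f * (p ^ n * p ^ n) * (p ^ n * p ^ n))) :: 'p ^ 'n ^ 'n) \<longlonglongrightarrow>
        transvection j i (- (f * 0 * 0))"
      by (intro tendsto_transvection tendsto_intros power_two_zero)
    then show ?thesis
      by (simp add: s_def adjugate_transvection[OF ij[symmetric]] transvection_zero)
  qed
  ultimately have "(\<lambda>n. (mat 1 + T n) ** s n ** adjugate (mat 1 + T n) ** adjugate (s n)) \<longlonglongrightarrow>
      transvection i j (- (f * (Y $ j $ i) * (Y $ j $ i))) ** mat 1" (is "?c \<longlonglongrightarrow> _")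
    by (rule tendsto_matrix_mult)
  \<comment> \<open>Bracketed differently, the commutator is an element of \<open>core\<close> times
    the \<open>SL F\<close>-conjugate of its inverse.\<close>
  moreover have "?c n \<in> core" for n
  proof -
    have "adjugate (mat 1 + T n) \<in> core"
      using core_div[OF one_core g_core] by simp
    from core_mult[OF g_core core_conj[OF s_F this]] show ?thesis
      by (simp add: matrix_mul_assoc)
  qed
  ultimately show ?thesis
    using Lim_in_closed_set[OF closed_core, of ?c sequentially] by simp
qed

text \<open>Otherwise \<open>core\<close> would contain a transvection with parameter one, which is
  an element of \<open>SL F\<close> different from the identity.\<close>

lemma exists_bounded_NB: "\<exists>U\<in>NB. \<not> unbounded U"
proof (rule ccontr)
  assume "\<not> ?thesis"
  then have "unbounded U" if "U \<in> NB" for U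
    using that by blast
  then obtain Y where Y: "mat 1 + Y \<in> core" "Y \<noteq> 0" "Y ** Y = 0"
    by (rule core_unipotent)
  \<comment> \<open>A diagonal matrix of square zero vanishes, so the nonzero \<open>Y\<close> has
    an off-diagonal entry.\<close>
  have "\<exists>i j. i \<noteq> j \<and> Y $ j $ i \<noteq> 0"
  proof (rule ccontr)
    assume off: "\<not> ?thesis"
    have "Y $ i $ i = 0" for i
    proof -
      have "(\<Sum>k\<in>UNIV. Y $ i $ k * Y $ k $ i) = Y $ i $ i * Y $ i $ i"
      proof (subst sum.remove[of _ i])
        have "Y $ i $ k = 0" if "k \<in> UNIV - {i}" for k
          using off that by blast
        then show "Y $ i $ i * Y $ i $ i + (\<Sum>k\<in>UNIV - {i}. Y $ i $ k * Y $ k $ i) = Y $ i $ i * Y $ i $ i"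
          by simp
      qed auto
      then show ?thesis
        using arg_cong[OF Y(3), of "\<lambda>A. A $ i $ i"] by (simp add: matrix_mult_nth)
    qed
    then show False
      using off Y(2) by (metis vec_eq_iff zero_index)
  qed
  then obtain i j where ij: "i \<noteq> j" "Y $ j $ i \<noteq> 0"
    by blast
  define y where "y = Y $ j $ i"
  have "(mat 1 + Y) $ j $ i \<in> closure F"
    using core_sub Y(1) by (auto simp: SL_def)
  then have y: "y \<in> closure F" "y \<noteq> 0"
    using ij by (auto simp: y_def mat_nth)
  \<comment> \<open>Since \<open>core\<close> is closed, the parameter \<open>f\<close> may run
    through the closure of \<open>F\<close>. There it can be minus the inverse square of
    \<open>y\<close>, which normalises the transvection to parameter one.\<close>
  have "continuous_on (closure F) (\<lambda>f. transvection i j (- (f * y * y)) :: 'p ^ 'n ^ 'n)"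
    unfolding continuous_on_def by (intro ballI tendsto_transvection tendsto_intros)
  then have "(\<lambda>f. transvection i j (- (f * y * y)) :: 'p ^ 'n ^ 'n) ` closure F \<subseteq> core"
    using core_transvection[OF Y(1,3) ij(1)] closed_core
    by (intro image_closure_subset) (auto simp: y_def)
  moreover interpret K: field_subring "closure F"
    by (intro closure_field_subring field_subring_axioms)
  have "- (inverse y * inverse y) \<in> closure F"
    by (intro K.uminus K.mult inverse_closure y)
  ultimately have "transvection i j (- (- (inverse y * inverse y) * y * y)) \<in> core"
    by blast
  then have "transvection i j 1 \<in> core"
    using y(2) by (simp add: mult.assoc)
  then have "transvection i j 1 = (mat 1 :: 'p ^ 'n ^ 'n)"
    using core_Int_SL SL_transvection[OF one ij(1)] by blast
  from arg_cong[OF this, of "\<lambda>A. A $ i $ j"] show False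
    using ij(1) by (simp add: transvection_nth mat_nth)
qed

text \<open>Conjugates of \<open>x\<close> by transvections with parameter \<open>k n\<close> stay
  in the bounded set \<open>core\<close>, yet they are quadratic polynomials in the unbounded
  \<open>k n\<close>. Both higher coefficients must vanish, and the linear one is the commutator
  with an elementary matrix.\<close>

lemma core_scalar:
  assumes x: "x \<in> core"
  shows "x = mat (x $ l $ l)"
proof (rule commutes_elem_mat_imp_scalar)
  fix i j :: 'n assume ij: "i \<noteq> j"
  obtain U N where U: "U \<in> NB" "\<And>g a b. g \<in> U \<Longrightarrow> g $ a $ b \<in> ball_p N"
    using exists_bounded_NB unfolding unbounded_def by blast
  have "closed {A :: 'p ^ 'n ^ 'n. A $ a $ b \<in> ball_p N}" for a b
  proof -
    have "continuous_on UNIV (\<lambda>A :: 'p ^ 'n ^ 'n. A $ a $ b)"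
      by (intro continuous_on_component continuous_on_id)
    from closed_vimage[OF compact_imp_closed[OF compact_ball_p] this] show ?thesis
      by (simp add: vimage_def)
  qed
  then have "closed {A :: 'p ^ 'n ^ 'n. \<forall>a b. A $ a $ b \<in> ball_p N}"
    by (intro closed_Collect_all)
  then have "closure U \<subseteq> {A. \<forall>a b. A $ a $ b \<in> ball_p N}"
    using U(2) by (intro closure_minimal) auto
  then have bounded: "A $ a $ b \<in> ball_p N" if "A \<in> core" for A a b
    using U(1) that by (auto simp: core_def)
  define k where "k n = inverse (p ^ n)" for n
  define T where "T n = transvection i j (k n) ** x ** transvection i j (- k n)" for n
  have k_F: "k n \<in> F" for n
    by (simp add: k_def inverse_F power_closed p_F)
  have pk: "p ^ n * k n = 1" for n
    using p_nonzero by (simp add: k_def)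
  have T: "T n $ a $ b = x $ a $ b + k n * ((if a = i then x $ j $ b else 0) - (if b = j then x $ a $ i else 0))
      - k n * k n * (if a = i \<and> b = j then x $ j $ i else 0)" for n a b
    by (simp add: T_def conj_by_transvection_nth[OF ij])
  have T_core: "T n \<in> core" for n
    using core_conj[OF SL_transvection[OF k_F ij] x, of n]
    by (simp add: T_def adjugate_transvection[OF ij])
  have lim: "(\<lambda>n. p ^ n * T n $ a $ b) \<longlonglongrightarrow> 0" for a b
    by (rule tendsto_power_times_bounded[OF compact_ball_p]) (rule bounded[OF T_core])
  \<comment> \<open>Multiplying by \<open>p ^ n * p ^ n\<close> isolates the quadratic coefficient;
    once it is known to vanish, a single factor \<open>p ^ n\<close> isolates the linear
    one.\<close>
  have x0: "x $ j $ i = 0"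
  proof -
    have "(p ^ n * p ^ n) * T n $ i $ j = (p ^ n * p ^ n) * x $ i $ j + p ^ n * (x $ j $ j - x $ i $ i) - x $ j $ i" for n
      unfolding T using rescaled_conjugate[OF pk] by simp
    then have "p ^ n * (p ^ n * x $ i $ j) + p ^ n * (x $ j $ j - x $ i $ i) - p ^ n * (p ^ n * T n $ i $ j)
      = x $ j $ i" for n
      by (simp add: mult.assoc)
    moreover have "(\<lambda>n. p ^ n * (p ^ n * x $ i $ j) + p ^ n * (x $ j $ j - x $ i $ i)
        - p ^ n * (p ^ n * T n $ i $ j)) \<longlonglongrightarrow> 0 * (0 * x $ i $ j) + 0 * (x $ j $ j - x $ i $ i) - 0 * 0"
      by (intro tendsto_intros p_power lim)
    ultimately show ?thesis
      by (simp add: LIMSEQ_const_iff)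
  qed
  have x1: "(if a = i then x $ j $ b else 0) - (if b = j then x $ a $ i else 0) = 0" (is "?d = 0") for a b
  proof -
    have "p ^ n * T n $ a $ b = p ^ n * x $ a $ b + (p ^ n * k n) * ?d" for n
      unfolding T x0 by (simp add: algebra_simps)
    then have "p ^ n * T n $ a $ b - p ^ n * x $ a $ b = ?d" for n
      by (simp add: pk)
    moreover have "(\<lambda>n. p ^ n * T n $ a $ b - p ^ n * x $ a $ b) \<longlonglongrightarrow> 0 - 0 * x $ a $ b"
      by (intro tendsto_intros p_power lim)
    ultimately show ?thesis
      by (simp add: LIMSEQ_const_iff)
  qed
  show "x ** elem_mat i j 1 = elem_mat i j 1 ** x"
    unfolding vec_eq_iff elem_mat_mult_nth mult_1_left mult_1_right
  proof (intro allI)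
    fix a b
    show "(if b = j then x $ a $ i else 0) = (if a = i then x $ j $ b else 0)"
      using x1[of a b] unfolding right_minus_eq by (rule sym)
  qed
qed

lemma core_central: "central_subgroup core (SL (closure F))"
proof -
  interpret K: field_subring "closure F"
    by (intro closure_field_subring field_subring_axioms)
  have "subgroup core (SL (closure F))"
  proof (rule group.subgroupI[OF K.group_SL])
    fix x y assume "x \<in> core" "y \<in> core"
    then show "x \<otimes>\<^bsub>SL (closure F)\<^esub> y \<in> core"
      by (simp add: K.mult_SL core_mult)
  next
    fix x assume x: "x \<in> core"
    then have "inv\<^bsub>SL (closure F)\<^esub> x = adjugate x"
      using core_sub by (intro K.inv_SL) auto
    then show "inv\<^bsub>SL (closure F)\<^esub> x \<in> core"
      using core_div[OF one_core x] by simp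
  qed (use core_sub one_core in auto)
  moreover have "core \<subseteq> group_center (SL (closure F))"
  proof
    fix x assume "x \<in> core"
    then have "x = mat (x $ undefined $ undefined)" "x \<in> carrier (SL (closure F))"
      using core_scalar core_sub by auto
    then show "x \<in> group_center (SL (closure F))"
      using K.scalar_in_center by metis
  qed
  ultimately show ?thesis
    by (simp add: central_subgroup_def)
qed

text \<open>If every member of \<open>NB\<close> left \<open>V\<close>, then so would its
  intersection with a bounded member, and compactness would give a point of \<open>core\<close>
  outside \<open>V\<close>.\<close>

lemma NB_base:
  assumes core: "core = {mat 1}" and V: "open V" "mat 1 \<in> V"
  shows "\<exists>U\<in>NB. U \<subseteq> V"
proof (rule ccontr)
  assume neg: "\<not> ?thesis"
  obtain U0 N where U0: "U0 \<in> NB" "\<And>g a b. g \<in> U0 \<Longrightarrow> g $ a $ b \<in> ball_p N"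
    using exists_bounded_NB unfolding unbounded_def by blast
  let ?Q = "{A :: 'p ^ 'n ^ 'n. \<forall>a b. A $ a $ b \<in> ball_p N} - V"
  have "core \<inter> ?Q \<noteq> {}"
  proof (rule core_meets)
    show "compact ?Q"
      by (intro compact_diff compact_mat_pointwise compact_ball_p V)
    fix U assume "U \<in> NB"
    then have "\<not> U \<inter> U0 \<subseteq> V"
      using neg NB_Int[OF _ U0(1)] by blast
    then show "U \<inter> ?Q \<noteq> {}"
      using U0(2) by blast
  qed
  then show False
    using core V(2) by auto
qed

end

section \<open>Subfields and discreteness\<close>

lemma subfield_ring_of_type_algebraD:
  fixes F :: "'a :: Fields.field set"
  assumes "subfield F ring_of_type_algebra"
  shows "field_subring F" and "x \<in> F \<Longrightarrow> inverse x \<in> F"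
proof -
  let ?R = "ring_of_type_algebra :: 'a ring"
  interpret R: ring ?R
    by (rule ring_from_type_algebra)
  have sub: "subring F ?R"
    using assms by (simp add: subfield_def subdomain_def subcring_def)
  note E = subringE[OF sub]
  have uminus: "\<ominus>\<^bsub>?R\<^esub> h = - h" for h
    by (rule R.minus_equality) (auto simp: ring_of_type_algebra_def)
  show "field_subring F"
    using E by unfold_locales (auto simp: ring_of_type_algebra_def uminus[unfolded ring_of_type_algebra_def])
  then interpret field_subring F .
  assume x: "x \<in> F"
  show "inverse x \<in> F"
  proof (cases "x = 0")
    case True
    then show ?thesis
      by (simp add: zero)
  next
    case False
    then have "x \<in> Units (?R\<lparr>carrier := F\<rparr>)"
      using subfield.subfield_Units[OF assms] x by (simp add: ring_of_type_algebra_def)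
    then obtain y where "y \<in> F" "y * x = 1"
      by (auto simp: Units_def ring_of_type_algebra_def)
    then show ?thesis
      using inverse_unique[of x y] by (simp add: mult.commute)
  qed
qed

text \<open>If zero is isolated in \<open>F\<close>, nonzero elements have no small inverses and so
  lie in one compact ball. An infinite \<open>F\<close> would accumulate there, and differences of
  nearby elements would be nonzero and small.\<close>

lemma discrete_subfield_finite:
  fixes F :: "'a :: local_field set"
  assumes "field_subring F" and inv: "\<And>x. x \<in> F \<Longrightarrow> inverse x \<in> F"
    and disc: "\<not> 0 islimpt F"
  shows "finite F"
proof (rule ccontr)
  assume inf: "infinite F"
  interpret field_subring F by fact
  obtain p :: 'a and C B where "contraction p C B"
    using contraction_exists[OF zero_islimpt_UNIV] by metis
  then interpret contraction p C B .
  obtain S where S: "open S" "0 \<in> S" "\<And>y. y \<in> F \<Longrightarrow> y \<in> S \<Longrightarrow> y = 0"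
    using disc by (auto simp: islimpt_def)
  obtain N where N: "\<And>x. x \<notin> ball_p N \<Longrightarrow> inverse x \<in> S"
    using inverse_small[OF S(1,2)] by blast
  have "F - {0} \<subseteq> ball_p N"
    using N S(3) inv by fastforce
  moreover have "infinite (F - {0})"
    using inf by simp
  ultimately obtain y where y: "y islimpt (F - {0})"
    using Heine_Borel_imp_Bolzano_Weierstrass[OF compact_ball_p, of "F - {0}" N] by blast
  define D where "D = (\<lambda>q. fst q - snd q) -` S"
  have "open D" "(y, y) \<in> D"
    using S by (auto simp: D_def intro!: open_vimage continuous_intros)
  then obtain V1 V2 where V: "open V1" "open V2" "y \<in> V1" "y \<in> V2" "V1 \<times> V2 \<subseteq> D"
    by (auto elim: open_prod_elim)
  obtain a where a: "a \<in> F" "a \<in> V1" "a \<noteq> y"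
    using islimptE[OF y V(3,1)] by blast
  \<comment> \<open>Removing \<open>a\<close>, which is not \<open>y\<close>, leaves a neighbourhood
    of \<open>y\<close> and ensures that \<open>a\<close> and \<open>b\<close> differ.\<close>
  obtain b where b: "b \<in> F" "b \<in> V2 - {a}" "b \<noteq> y"
    using islimptE[OF y, of "V2 - {a}"] V a by blast
  have "a - b \<in> S"
    using V(5) a b by (force simp: D_def)
  then have "a - b = 0"
    using S(3) diff_closed a b by blast
  with b show False
    by simp
qed

section \<open>From group topologies to neighbourhood systems\<close>

lemma hausdorff_group_topology_SL:
  fixes F :: "'p :: local_field set"
  assumes "field_subring F"
  shows "hausdorff_group_topology (SL F :: ('p ^ 'n ^ 'n) monoid) (SL_topology F)"
proof -
  interpret field_subring F by fact
  let ?S = "carrier (SL F :: ('p ^ 'n ^ 'n) monoid)"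
  have "continuous_map (top_of_set (?S \<times> ?S)) (top_of_set ?S) (\<lambda>(x, y). x ** y)"
    by (auto simp: case_prod_unfold SL_mult intro!: continuous_intros)
  moreover have "continuous_map (top_of_set ?S) (top_of_set ?S) (\<lambda>x. inv\<^bsub>SL F\<^esub> x)"
  proof -
    have "continuous_map (top_of_set ?S) (top_of_set ?S) adjugate"
      by (auto simp: SL_adjugate intro!: continuous_on_adjugate continuous_on_id)
    then show ?thesis
      by (rule continuous_map_eq) (auto simp: inv_SL)
  qed
  moreover have "Hausdorff_space (top_of_set ?S)"
  proof (intro Hausdorff_space_subtopology)
    show "Hausdorff_space (euclidean :: ('p ^ 'n ^ 'n) topology)"
      unfolding Hausdorff_space_def disjnt_def using hausdorff by fastforce
  qed
  ultimately show ?thesis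
    by (simp add: hausdorff_group_topology_def SL_topology_def group_SL mult_SL prod_topology_subtopology_eu)
qed

lemma coarser_topology_nbhds:
  fixes F :: "'p :: local_field set" and T' :: "('p ^ 'n ^ 'n) topology"
  assumes F: "field_subring F"
    and T': "hausdorff_group_topology (SL F) T'"
    and coarser: "\<And>U. openin T' U \<Longrightarrow> openin (SL_topology F) U"
  shows "coarse_nbhds F {U. openin T' U \<and> mat 1 \<in> U}"
proof -
  interpret field_subring F by fact
  let ?S = "carrier (SL F :: ('p ^ 'n ^ 'n) monoid)"
  have top: "topspace T' = ?S" and haus: "Hausdorff_space T'"
    and cmult: "continuous_map (prod_topology T' T') T' (\<lambda>(x, y). x ** y)"
    and cinv: "continuous_map T' T' (\<lambda>x. inv\<^bsub>SL F\<^esub> x)"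
    using T' by (auto simp: hausdorff_group_topology_def mult_SL)
  have cadj: "continuous_map T' T' adjugate"
    using cinv by (rule continuous_map_eq) (simp add: top inv_SL)
  have cdiv: "continuous_map (prod_topology T' T') T' (\<lambda>q. fst q ** adjugate (snd q))"
    using continuous_map_compose[OF _ cmult, of "prod_topology T' T'" "\<lambda>q. (fst q, adjugate (snd q))"]
      continuous_map_compose[OF continuous_map_snd[of T' T'] cadj] continuous_map_fst[of T' T']
    by (simp add: o_def continuous_map_pairwise)
  have cconj: "continuous_map T' T' (\<lambda>x. g ** x ** adjugate g)" if "g \<in> ?S" for g
  proof -
    have l: "continuous_map T' T' (\<lambda>x. g ** x)"
      using continuous_map_compose[OF _ cmult, of T' "\<lambda>x. (g, x)"] that
      by (simp add: o_def continuous_map_pairwise top)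
    show ?thesis
      using continuous_map_compose[OF _ cmult, of T' "\<lambda>x. (g ** x, adjugate g)"] that l
      by (simp add: o_def continuous_map_pairwise top SL_adjugate)
  qed
  have inS: "U \<subseteq> ?S" if "openin T' U" for U
    using openin_subset[OF that] top by simp
  show ?thesis
  proof unfold_locales
    fix U assume "U \<in> {U. openin T' U \<and> mat 1 \<in> U}"
    then have U: "openin T' U" "mat 1 \<in> U"
      by auto
    show "mat 1 \<in> U"
      by fact
    show "\<exists>V. open V \<and> U = V \<inter> ?S"
      using coarser[OF U(1)] by (auto simp: SL_topology_def openin_open)
    show "U \<inter> V \<in> {U. openin T' U \<and> mat 1 \<in> U}" if "V \<in> {U. openin T' U \<and> mat 1 \<in> U}" for V
      using U that by auto
    have "openin (prod_topology T' T') {q \<in> topspace (prod_topology T' T'). fst q ** adjugate (snd q) \<in> U}"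
      using openin_continuous_map_preimage[OF cdiv U(1)] by simp
    moreover have "adjugate (mat 1) = (mat 1 :: 'p ^ 'n ^ 'n)"
      by (rule adjugate_unique) auto
    ultimately obtain W1 W2 where W: "openin T' W1" "openin T' W2" "mat 1 \<in> W1" "mat 1 \<in> W2"
      "W1 \<times> W2 \<subseteq> {q \<in> topspace (prod_topology T' T'). fst q ** adjugate (snd q) \<in> U}"
      unfolding openin_prod_topology_alt
      by (elim allE[of _ "mat 1"]) (use U(2) SL_one in \<open>auto simp: top\<close>)
    then show "\<exists>W\<in>{U. openin T' U \<and> mat 1 \<in> U}. \<forall>x\<in>W. \<forall>y\<in>W. x ** adjugate y \<in> U"
      by (intro bexI[of _ "W1 \<inter> W2"]) auto
    fix g assume g: "g \<in> ?S"
    then have detg: "det g = 1"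
      by (simp add: SL_iff)
    show "\<exists>W\<in>{U. openin T' U \<and> mat 1 \<in> U}. \<forall>x\<in>W. g ** x ** adjugate g \<in> U"
    proof (intro bexI)
      show "{x \<in> topspace T'. g ** x ** adjugate g \<in> U} \<in> {U. openin T' U \<and> mat 1 \<in> U}"
        using openin_continuous_map_preimage[OF cconj[OF g] U(1)] g U(2)
        by (simp add: top SL_one mult_adjugate detg)
    qed auto
  next
    have "openin T' ?S"
      using openin_topspace[of T'] top by simp
    then show "{U. openin T' U \<and> mat 1 \<in> U} \<noteq> {}"
      using SL_one by blast
  next
    fix x assume x: "x \<in> ?S" "x \<noteq> mat 1"
    then obtain U V where UV: "openin T' U" "openin T' V" "mat 1 \<in> U" "x \<in> V" "disjnt U V"
      using haus SL_one unfolding Hausdorff_space_def top by metis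
    obtain V' where V': "open V'" "V = ?S \<inter> V'"
      using coarser[OF UV(2)] by (auto simp: SL_topology_def openin_open)
    \<comment> \<open>The extension \<open>V'\<close> of \<open>V\<close> to the matrix space still
      misses \<open>U\<close>, because \<open>U\<close> lies in \<open>SL F\<close>. This gives
      separation by closures among all matrices.\<close>
    have "V' \<inter> U = {}"
      using UV(5) V'(2) inS[OF UV(1)] by (auto simp: disjnt_def)
    then have "x \<notin> closure U"
      using open_Int_closure_eq_empty[OF V'(1)] UV(4) V'(2) by blast
    then show "\<exists>U\<in>{U. openin T' U \<and> mat 1 \<in> U}. x \<notin> closure U"
      using UV by blast
  qed
qed

text \<open>For \<open>F\<close> discrete the group is finite, and a finite Hausdorff space is
  discrete. Otherwise the hypothesis applied to \<open>core\<close> makes it trivial, so the two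
  topologies agree at the identity and, by translation, everywhere.\<close>

lemma coarser_eq_if_essential:
  fixes F :: "'p :: local_field set" and T' :: "('p ^ 'n ^ 'n) topology"
  assumes F: "field_subring F" "\<And>x. x \<in> F \<Longrightarrow> inverse x \<in> F"
    and T': "hausdorff_group_topology (SL F) T'"
    and coarser: "\<And>U. openin T' U \<Longrightarrow> openin (SL_topology F) U"
    and essential: "\<And>H. central_subgroup H (SL (closure F) :: ('p ^ 'n ^ 'n) monoid) \<Longrightarrow> H \<noteq> {mat 1}
       \<Longrightarrow> H \<inter> carrier (SL F) \<noteq> {mat 1}"
    and V: "openin (SL_topology F) V"
  shows "openin T' V"
proof (cases "0 islimpt F")
  case False
  interpret field_subring F by fact
  have "finite F"
    using discrete_subfield_finite[OF F False] .
  then have "finite ((\<lambda>f. \<chi> i j. f (i, j)) ` PiE (UNIV :: ('n \<times> 'n) set) (\<lambda>_. F) :: ('p ^ 'n ^ 'n) set)"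
    by (intro finite_imageI finite_PiE) auto
  moreover have "carrier (SL F) \<subseteq> (\<lambda>f. \<chi> i j. f (i, j)) ` PiE (UNIV :: ('n \<times> 'n) set) (\<lambda>_. F)"
  proof
    fix A :: "'p ^ 'n ^ 'n" assume "A \<in> carrier (SL F)"
    then show "A \<in> (\<lambda>f. \<chi> i j. f (i, j)) ` PiE (UNIV :: ('n \<times> 'n) set) (\<lambda>_. F)"
      by (intro image_eqI[of _ _ "\<lambda>q. A $ fst q $ snd q"]) (auto simp: SL_def)
  qed
  ultimately have "finite (carrier (SL F :: ('p ^ 'n ^ 'n) monoid))"
    by (rule finite_subset[rotated])
  then have "T' = discrete_topology (carrier (SL F))"
    using T' by (intro finite_t1_space_imp_discrete_topology Hausdorff_imp_t1_space)
      (auto simp: hausdorff_group_topology_def)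
  then show ?thesis
    using openin_subset[OF V] by (simp add: SL_topology_def)
next
  case True
  define NB where "NB = {U. openin T' U \<and> mat 1 \<in> U}"
  obtain p C B where p: "p \<in> F" "contraction p C B"
    using contraction_exists[OF True] by metis
  interpret N: contracted_nbhds F NB p C B
    using coarser_topology_nbhds[OF F(1) T' coarser] p F(2)
    by (simp add: contracted_nbhds_def contracted_nbhds_axioms_def NB_def)
  let ?S = "carrier (SL F :: ('p ^ 'n ^ 'n) monoid)"
  have top: "topspace T' = ?S"
    and cmult: "continuous_map (prod_topology T' T') T' (\<lambda>(x, y). x ** y)"
    using T' by (auto simp: hausdorff_group_topology_def N.mult_SL)
  have "N.core = {mat 1}"
    using essential[OF N.core_central] N.core_Int_SL by blast
  note base = N.NB_base[OF this]
  obtain O' where O': "open O'" "V = ?S \<inter> O'"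
    using V by (auto simp: SL_topology_def openin_open)
  show ?thesis
    unfolding openin_subopen[of T' V]
  proof
    fix x assume x: "x \<in> V"
    then have detx: "det x = 1" and xS: "x \<in> ?S"
      using O' by (auto simp: N.SL_iff)
    have "open ((\<lambda>y. x ** y) -` O')"
      using O' by (intro open_vimage continuous_intros)
    then obtain U where U: "U \<in> NB" "U \<subseteq> (\<lambda>y. x ** y) -` O'"
      using base[of "(\<lambda>y. x ** y) -` O'"] x O' by auto
    have c: "continuous_map T' T' (\<lambda>y. adjugate x ** y)"
      using continuous_map_compose[OF _ cmult, of T' "\<lambda>y. (adjugate x, y)"] N.SL_adjugate[OF xS]
      by (simp add: o_def continuous_map_pairwise top)
    have "openin T' {y \<in> topspace T'. adjugate x ** y \<in> U}"
      using U(1) by (intro openin_continuous_map_preimage[OF c]) (simp add: NB_def)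
    moreover have "x \<in> {y \<in> topspace T'. adjugate x ** y \<in> U}"
      using U(1) xS by (simp add: top mult_adjugate detx NB_def)
    moreover have "{y \<in> topspace T'. adjugate x ** y \<in> U} \<subseteq> V"
    proof
      fix y assume y: "y \<in> {y \<in> topspace T'. adjugate x ** y \<in> U}"
      then have "x ** (adjugate x ** y) \<in> O'"
        using U(2) by blast
      then show "y \<in> V"
        using y O'(2) by (simp add: matrix_mul_assoc mult_adjugate detx top)
    qed
    ultimately show "\<exists>T. openin T' T \<and> x \<in> T \<and> T \<subseteq> V"
      by blast
  qed
qed

section \<open>Quotients by groups of scalars\<close>

lemma det_mat: "det (mat z :: 'a :: comm_ring_1 ^ 'n ^ 'n) = z ^ CARD('n)"
  by (simp add: det_diagonal mat_nth)

text \<open>Here \<open>z\<close> is an \<open>n\<close>-th root of unity for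
  \<open>n = CARD('n)\<close>. The diagonal matrix with \<open>f\<close> in all places but one, and
  the compensating inverse power in the last, has determinant one over \<open>F\<close> and tends to
  \<open>mat z\<close> as \<open>f\<close> tends to \<open>z\<close>.\<close>

lemma scalar_approximable:
  fixes F :: "'p :: local_field set"
  assumes F: "field_subring F" "\<And>x. x \<in> F \<Longrightarrow> inverse x \<in> F"
    and z: "(mat z :: 'p ^ 'n ^ 'n) \<in> carrier (SL (closure F))"
    and O': "open O'" "(mat z :: 'p ^ 'n ^ 'n) \<in> O'"
  shows "carrier (SL F) \<inter> O' \<noteq> {}"
proof -
  interpret field_subring F by fact
  let ?n = "CARD('n) - 1"
  define k :: 'n where "k = undefined"
  define D :: "'p \<Rightarrow> 'p ^ 'n ^ 'n" where
    "D f = (\<chi> a b. if a = b then (if a = k then inverse (f ^ ?n) else f) else 0)" for f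
  have z1: "z * z ^ ?n = 1"
    using z by (simp add: SL_def det_mat power_Suc[symmetric] del: power_Suc)
  then have z0: "z \<noteq> 0" "z ^ ?n \<noteq> 0"
    by auto
  have zF: "z \<in> closure F"
    using z by (auto simp: SL_def mat_nth split: if_splits)
  have D_SL: "D f \<in> carrier (SL F)" if "f \<in> F" "f \<noteq> 0" for f
  proof -
    have "det (D f) = (\<Prod>a\<in>UNIV. if a = k then inverse (f ^ ?n) else f)"
      by (simp add: D_def det_diagonal)
    also have "\<dots> = inverse (f ^ ?n) * (\<Prod>a\<in>UNIV - {k}. f)"
      by (subst prod.remove[of _ k]) (auto intro!: prod.cong)
    also have "\<dots> = 1"
      using that by (simp add: card_Diff_singleton)
    finally show ?thesis
      using that by (auto simp: SL_def D_def zero power_closed F(2))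
  qed
  have "((\<lambda>f. D f $ a $ b) \<longlongrightarrow> mat z $ a $ b) (nhds z)" for a b
  proof -
    have "((\<lambda>f. f ^ ?n) \<longlongrightarrow> z ^ ?n) (nhds z)"
      by (induction ?n) (auto intro!: tendsto_intros simp: filterlim_ident)
    then have "((\<lambda>f. inverse (f ^ ?n)) \<longlongrightarrow> inverse (z ^ ?n)) (nhds z)"
      by (rule filterlim_compose[OF tendsto_inverse_nhds[OF z0(2)]])
    \<comment> \<open>This is where determinant one of \<open>mat z\<close> enters: the exceptional
      diagonal entry has the same limit as the others.\<close>
    moreover have "inverse (z ^ ?n) = z"
      using z1 by (intro inverse_unique) (simp add: mult.commute)
    moreover have "((\<lambda>f. f) \<longlongrightarrow> z) (nhds z)"
      by (rule filterlim_ident)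
    ultimately show ?thesis
      by (cases "a = b"; cases "a = k") (auto simp: D_def mat_nth)
  qed
  then have "(D \<longlongrightarrow> mat z) (nhds z)"
    by (simp add: tendsto_matrix_iff)
  then have "eventually (\<lambda>f. D f \<in> O') (nhds z)"
    using O' by (rule topological_tendstoD)
  then obtain S where S: "open S" "z \<in> S" "\<And>f. f \<in> S \<Longrightarrow> D f \<in> O'"
    unfolding eventually_nhds by blast
  have "open (S - {0})" "z \<in> S - {0}"
    using S z0 by auto
  then obtain f where "f \<in> S" "f \<noteq> 0" "f \<in> F"
    using zF open_Int_closure_eq_empty[of "S - {0}" F] by blast
  then show ?thesis
    using D_SL S(3) by blast
qed

text \<open>The image of \<open>SL F\<close> in the quotient by a central subgroup \<open>H\<close> of the group over the closure
  carries this topology.\<close>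

definition invariant_topology :: "('a :: {topological_space, semiring_1} ^ 'n ^ 'n) set \<Rightarrow> ('a ^ 'n ^ 'n) topology"
  where "invariant_topology H = topology (\<lambda>V. open V \<and> (\<forall>h\<in>H. \<forall>A\<in>V. h ** A \<in> V))"

lemma openin_invariant_topology:
  fixes H :: "('a :: {topological_space, semiring_1} ^ 'b ^ 'b) set"
  shows "openin (invariant_topology H) V \<longleftrightarrow> open V \<and> (\<forall>h\<in>H. \<forall>A\<in>V. h ** A \<in> V)"
proof -
  have "istopology (\<lambda>V :: ('a ^ 'b ^ 'b) set. open V \<and> (\<forall>h\<in>H. \<forall>A\<in>V. h ** A \<in> V))"
    unfolding istopology_def by blast
  from topology_inverse'[OF this] show ?thesis
    by (simp add: invariant_topology_def)
qed

lemma topspace_invariant_topology: "topspace (invariant_topology H) = UNIV"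
proof -
  have "openin (invariant_topology H) UNIV"
    by (simp add: openin_invariant_topology)
  then show ?thesis
    using openin_subset by blast
qed

section \<open>Quotient topology modulo a group of scalars\<close>

locale scalar_group = field_subring F for F :: "'p :: local_field set" +
  fixes H :: "('p ^ 'n ^ 'n) set"
  assumes H_scalar: "h \<in> H \<Longrightarrow> \<exists>z. h = mat z"
    and H_det: "h \<in> H \<Longrightarrow> det h = 1"
    and H_one: "mat 1 \<in> H"
    and H_mult: "h \<in> H \<Longrightarrow> h' \<in> H \<Longrightarrow> h ** h' \<in> H"
    and H_adjugate: "h \<in> H \<Longrightarrow> adjugate h \<in> H"
    and H_SL: "H \<inter> carrier (SL F) = {mat 1}"
begin

lemma H_commute: "h \<in> H \<Longrightarrow> h ** A = A ** h"
  using H_scalar mat_mult_commute by metis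

lemma H_cancel: "h \<in> H \<Longrightarrow> adjugate h ** (h ** A) = A"
  by (simp add: matrix_mul_assoc mult_adjugate H_det)

text \<open>The scalars in \<open>H\<close> have determinant one, so they are roots of unity and
  hence roots of one nonzero polynomial.\<close>

lemma finite_H: "finite H"
proof -
  have "H \<subseteq> mat ` {z. z ^ CARD('n) = 1}"
    using H_scalar H_det det_mat by (metis (mono_tags, lifting) image_eqI mem_Collect_eq subsetI)
  moreover have "finite {z :: 'p. z ^ CARD('n) = 1}"
  proof -
    let ?q = "Polynomial.monom 1 (CARD('n)) - 1 :: 'p poly"
    have "?q \<noteq> 0"
      using zero_less_card_finite[where 'a = 'n] by (metis degree_1 degree_monom_eq eq_iff_diff_eq_0 less_irrefl zero_neq_one)
    then show ?thesis
      using poly_roots_finite[of ?q] by (simp add: poly_monom)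
  qed
  ultimately show ?thesis
    by (meson finite_imageI finite_subset)
qed

text \<open>As \<open>H\<close> is a group, this is the union of the \<open>H\<close>-translates of
  \<open>P\<close>, the smallest invariant set containing \<open>P\<close>.\<close>

definition saturation :: "('p ^ 'n ^ 'n) set \<Rightarrow> ('p ^ 'n ^ 'n) set"
  where "saturation P = {A. \<exists>h\<in>H. h ** A \<in> P}"

lemma saturation_sub: "P \<subseteq> saturation P"
  using H_one by (force simp: saturation_def)

lemma openin_saturation:
  assumes "open P"
  shows "openin (invariant_topology H) (saturation P)"
proof -
  have "saturation P = (\<Union>h\<in>H. (\<lambda>A. h ** A) -` P)"
    by (auto simp: saturation_def)
  then have "open (saturation P)"
    using assms by (auto intro!: open_vimage continuous_intros)
  moreover have "k ** A \<in> saturation P" if k: "k \<in> H" and A: "A \<in> saturation P" for k A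
  proof -
    obtain h where h: "h \<in> H" "h ** A \<in> P"
      using A by (auto simp: saturation_def)
    have "(h ** adjugate k) ** (k ** A) = h ** A"
      using H_cancel[OF k, of A] by (simp add: matrix_mul_assoc[symmetric])
    then show ?thesis
      using h H_mult H_adjugate k by (auto simp: saturation_def intro!: bexI[of _ "h ** adjugate k"])
  qed
  ultimately show ?thesis
    by (simp add: openin_invariant_topology)
qed

abbreviation quotient_topology :: "('p ^ 'n ^ 'n) topology"
  where "quotient_topology \<equiv> subtopology (invariant_topology H) (carrier (SL F))"

text \<open>Distinct \<open>x\<close> and \<open>y\<close> in \<open>SL F\<close> lie in different
  \<open>H\<close>-orbits, since \<open>H\<close> meets \<open>SL F\<close> trivially. Finiteness of
  \<open>H\<close> allows separating neighbourhoods for all translates to be intersected.\<close>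

lemma hausdorff_quotient: "Hausdorff_space quotient_topology"
  unfolding Hausdorff_space_def
proof (intro allI impI)
  fix x y assume xy: "x \<in> topspace quotient_topology \<and> y \<in> topspace quotient_topology \<and> x \<noteq> y"
  then have S: "x \<in> carrier (SL F)" "y \<in> carrier (SL F)" "x \<noteq> y"
    by auto
  have "\<exists>A B. open A \<and> open B \<and> x \<in> A \<and> h ** y \<in> B \<and> A \<inter> B = {}" if "h \<in> H" for h
  proof (intro hausdorff notI)
    assume eq: "x = h ** y"
    have "x ** adjugate y = h ** (y ** adjugate y)"
      by (simp add: eq matrix_mul_assoc)
    then have "h = x ** adjugate y"
      using S by (simp add: mult_adjugate SL_iff)
    then have "h \<in> carrier (SL F)"
      using S by (simp add: SL_mult SL_adjugate)
    then have "h = mat 1"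
      using that H_SL by blast
    then show False
      using eq S by simp
  qed
  then obtain A B where AB: "\<And>h. h \<in> H \<Longrightarrow> open (A h) \<and> open (B h) \<and> x \<in> A h \<and> h ** y \<in> B h \<and> A h \<inter> B h = {}"
    by metis
  define P where "P = (\<Inter>h\<in>H. A h)"
  define Q where "Q = (\<Inter>h\<in>H. (\<lambda>z. h ** z) -` B h)"
  have op: "open P" "open Q"
    unfolding P_def Q_def using AB finite_H by (auto intro!: open_INT open_vimage continuous_intros)
  have xP: "x \<in> P" and yQ: "y \<in> Q"
    using AB by (auto simp: P_def Q_def)
  have "saturation P \<inter> saturation Q = {}"
  proof (rule ccontr)
    assume "saturation P \<inter> saturation Q \<noteq> {}"
    then obtain z h k where z: "h \<in> H" "k \<in> H" "h ** z \<in> P" "k ** z \<in> Q"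
      by (auto simp: saturation_def)
    \<comment> \<open>A common point of the saturations is moved into \<open>P\<close> by
      \<open>h\<close> and into \<open>Q\<close> by \<open>k\<close>. The quotient of these two
      scalars is the index at which \<open>A\<close> and \<open>B\<close> were chosen
      disjoint.\<close>
    have l: "h ** adjugate k \<in> H"
      using z H_mult H_adjugate by blast
    have "(h ** adjugate k) ** (k ** z) = h ** z"
      using H_cancel[OF z(2), of z] by (simp add: matrix_mul_assoc[symmetric])
    then have "h ** z \<in> B (h ** adjugate k)"
      using z(4) l by (force simp: Q_def)
    moreover have "h ** z \<in> A (h ** adjugate k)"
      using z(3) l by (auto simp: P_def)
    ultimately show False
      using AB[OF l] by blast
  qed
  then show "\<exists>U V. openin quotient_topology U \<and> openin quotient_topology V \<and> x \<in> U \<and> y \<in> V \<and> disjnt U V"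
    using openin_saturation[OF op(1)] openin_saturation[OF op(2)] xP yQ S saturation_sub
    by (intro exI[of _ "saturation P \<inter> carrier (SL F)"] exI[of _ "saturation Q \<inter> carrier (SL F)"])
      (auto simp: openin_subtopology disjnt_def)
qed

text \<open>Elements of \<open>H\<close> commute with all matrices, so scalars introduced by
  saturating can be pulled out of products and inverses, and then dropped because the target is
  invariant.\<close>

lemma group_topology_quotient: "hausdorff_group_topology (SL F) quotient_topology"
proof -
  let ?S = "carrier (SL F :: ('p ^ 'n ^ 'n) monoid)"
  have top: "topspace quotient_topology = ?S"
    by (simp add: topspace_invariant_topology)
  have inv_cancel: "A \<in> V" if "openin (invariant_topology H) V" "h \<in> H" "h ** A \<in> V" for V h A
    using that H_cancel[OF that(2)] H_adjugate by (metis openin_invariant_topology)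
  have "continuous_map (prod_topology quotient_topology quotient_topology) quotient_topology (\<lambda>(x, y). x ** y)"
    unfolding continuous_map_def
  proof (intro conjI allI impI)
    show "(\<lambda>(x, y). x ** y) \<in> topspace (prod_topology quotient_topology quotient_topology) \<rightarrow> topspace quotient_topology"
      by (auto simp: top SL_mult simp del: topspace_subtopology)
  next
    fix U assume "openin quotient_topology U"
    then obtain V where V: "openin (invariant_topology H) V" "U = V \<inter> ?S"
      by (auto simp: openin_subtopology)
    show "openin (prod_topology quotient_topology quotient_topology)
      {q \<in> topspace (prod_topology quotient_topology quotient_topology). (case q of (x, y) \<Rightarrow> x ** y) \<in> U}"
      unfolding openin_prod_topology_alt
    proof (intro allI impI)
      fix x y
      assume "(x, y) \<in> {q \<in> topspace (prod_topology quotient_topology quotient_topology). (case q of (x, y) \<Rightarrow> x ** y) \<in> U}"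
      then have xy: "x \<in> ?S" "y \<in> ?S" "x ** y \<in> V"
        using V by (auto simp: top simp del: topspace_subtopology)
      have "open ((\<lambda>q :: ('p ^ 'n ^ 'n) \<times> ('p ^ 'n ^ 'n). fst q ** snd q) -` V)"
        using V by (auto simp: openin_invariant_topology intro!: open_vimage continuous_intros)
      then obtain P Q where PQ: "open P" "open Q" "x \<in> P" "y \<in> Q" "P \<times> Q \<subseteq> (\<lambda>q. fst q ** snd q) -` V"
        using xy by (auto elim: open_prod_elim[of _ "(x, y)"])
      have sat: "a ** b \<in> V" if ab: "a \<in> saturation P" "b \<in> saturation Q" for a b
      proof -
        obtain h k where hk: "h \<in> H" "k \<in> H" "h ** a \<in> P" "k ** b \<in> Q"
          using ab by (auto simp: saturation_def)
        then have "(h ** a) ** (k ** b) \<in> V"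
          using PQ(5) by force
        also have "(h ** a) ** (k ** b) = h ** (k ** (a ** b))"
          using H_commute[OF hk(2), of a] by (metis matrix_mul_assoc)
        finally show ?thesis
          using inv_cancel[OF V(1)] hk by blast
      qed
      show "\<exists>U' V'. openin quotient_topology U' \<and> openin quotient_topology V' \<and> x \<in> U' \<and> y \<in> V' \<and>
        U' \<times> V' \<subseteq> {q \<in> topspace (prod_topology quotient_topology quotient_topology). (case q of (x, y) \<Rightarrow> x ** y) \<in> U}"
      proof (intro exI conjI)
        show "openin quotient_topology (saturation P \<inter> ?S)" "openin quotient_topology (saturation Q \<inter> ?S)"
          using openin_saturation PQ by (auto simp: openin_subtopology)
        show "x \<in> saturation P \<inter> ?S" "y \<in> saturation Q \<inter> ?S"
          using PQ saturation_sub xy by auto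
        show "(saturation P \<inter> ?S) \<times> (saturation Q \<inter> ?S) \<subseteq>
          {q \<in> topspace (prod_topology quotient_topology quotient_topology). (case q of (x, y) \<Rightarrow> x ** y) \<in> U}"
          using sat V(2) by (auto simp: top SL_mult simp del: topspace_subtopology)
      qed
    qed
  qed
  moreover have "continuous_map quotient_topology quotient_topology adjugate"
    unfolding continuous_map_def
  proof (intro conjI allI impI)
    show "adjugate \<in> topspace quotient_topology \<rightarrow> topspace quotient_topology"
      by (auto simp: top SL_adjugate simp del: topspace_subtopology)
  next
    fix U assume "openin quotient_topology U"
    then obtain V where V: "openin (invariant_topology H) V" "U = V \<inter> ?S"
      by (auto simp: openin_subtopology)
    have "open (adjugate -` V)"
      using V by (auto simp: openin_invariant_topology intro!: open_vimage continuous_intros)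
    then have "openin quotient_topology (saturation (adjugate -` V) \<inter> ?S)"
      using openin_saturation by (auto simp: openin_subtopology)
    moreover have "saturation (adjugate -` V) \<inter> ?S = {x \<in> topspace quotient_topology. adjugate x \<in> U}"
    proof -
      have "adjugate x \<in> V" if x: "x \<in> ?S" and h: "h \<in> H" "adjugate (h ** x) \<in> V" for x h
      proof (rule inv_cancel[OF V(1) H_adjugate[OF h(1)]])
        show "adjugate h ** adjugate x \<in> V"
          using h x H_commute[OF H_adjugate[OF h(1)]] by (simp add: adjugate_mult H_det SL_iff)
      qed
      then show ?thesis
        using V(2) saturation_sub[of "adjugate -` V"]
        by (auto simp: top SL_adjugate saturation_def simp del: topspace_subtopology)
    qed
    ultimately show "openin quotient_topology {x \<in> topspace quotient_topology. adjugate x \<in> U}"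
      by simp
  qed
  then have "continuous_map quotient_topology quotient_topology (\<lambda>x. inv\<^bsub>SL F\<^esub> x)"
    by (rule continuous_map_eq) (simp add: top inv_SL del: topspace_subtopology)
  ultimately show ?thesis
    by (simp add: hausdorff_group_topology_def group_SL mult_SL hausdorff_quotient top del: topspace_subtopology)
qed

text \<open>Every invariant neighbourhood of the identity contains all of \<open>H\<close>, and
  \<open>H\<close> is approximated from \<open>SL F\<close>. So a set open in the inherited topology
  that stays away from some \<open>h\<close> in \<open>H\<close> cannot be open in the
  quotient.\<close>

lemma quotient_strictly_coarser:
  assumes inv: "\<And>x. x \<in> F \<Longrightarrow> inverse x \<in> F"
    and H: "H \<subseteq> carrier (SL (closure F))" "H \<noteq> {mat 1}"
  shows "strictly_coarser quotient_topology (SL_topology F)"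
proof -
  let ?S = "carrier (SL F :: ('p ^ 'n ^ 'n) monoid)"
  obtain h where h: "h \<in> H" "h \<noteq> mat 1"
    using H(2) H_one by blast
  obtain O1 O2 where O: "open O1" "open O2" "mat 1 \<in> O1" "h \<in> O2" "O1 \<inter> O2 = {}"
    using hausdorff[of "mat 1" h] h(2) by auto
  have "\<not> openin quotient_topology (O1 \<inter> ?S)"
  proof
    assume "openin quotient_topology (O1 \<inter> ?S)"
    then obtain V where V: "openin (invariant_topology H) V" "O1 \<inter> ?S = V \<inter> ?S"
      by (auto simp: openin_subtopology)
    then have "mat 1 \<in> V"
      using O(3) SL_one by blast
    then have "h ** mat 1 \<in> V"
      using V(1) h(1) unfolding openin_invariant_topology by blast
    then have hV: "h \<in> V"
      by simp
    obtain z where z: "h = mat z"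
      using H_scalar h(1) by blast
    \<comment> \<open>A point of \<open>SL F\<close> close to \<open>h\<close> lies in
      \<open>V\<close> and in \<open>O2\<close>; but on \<open>SL F\<close> the set \<open>V\<close>
      agrees with \<open>O1\<close>, which is disjoint from \<open>O2\<close>.\<close>
    have "?S \<inter> (V \<inter> O2) \<noteq> {}"
    proof (rule scalar_approximable[OF field_subring_axioms inv])
      show "(mat z :: 'p ^ 'n ^ 'n) \<in> carrier (SL (closure F))"
        using H(1) h(1) z by blast
      show "open (V \<inter> O2)" "mat z \<in> V \<inter> O2"
        using V(1) O hV z by (auto simp: openin_invariant_topology)
    qed
    then show False
      using V(2) O(5) by blast
  qed
  moreover have "openin (SL_topology F) (O1 \<inter> ?S)"
    using O(1) by (auto simp: SL_topology_def openin_open)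
  moreover have "openin (SL_topology F) U" if "openin quotient_topology U" for U
    using that by (auto simp: SL_topology_def openin_open openin_subtopology openin_invariant_topology)
  ultimately show ?thesis
    by (auto simp: strictly_coarser_def topspace_invariant_topology SL_topology_def)
qed

end

theorem proposition5p1:
  fixes F :: "'p :: local_field set"
  assumes "subfield F ring_of_type_algebra"
  shows "minimal_topological_group (SL F :: ('p ^ 'n ^ 'n) monoid) (SL_topology F) \<longleftrightarrow>
    (\<forall>H. central_subgroup H (SL (closure F) :: ('p ^ 'n ^ 'n) monoid) \<and> H \<noteq> {mat 1}
       \<longrightarrow> H \<inter> carrier (SL F) \<noteq> {mat 1})"
proof -
  note F = subfield_ring_of_type_algebraD[OF assms]
  interpret field_subring F
    by (rule F)
  interpret K: field_subring "closure F"
    by (intro closure_field_subring F)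
  show ?thesis
  proof
    assume "minimal_topological_group (SL F :: ('p ^ 'n ^ 'n) monoid) (SL_topology F)"
    then have minimal: "\<not> strictly_coarser T' (SL_topology F)"
      if "hausdorff_group_topology (SL F :: ('p ^ 'n ^ 'n) monoid) T'" for T'
      using that by (auto simp: minimal_topological_group_def)
    show "\<forall>H. central_subgroup H (SL (closure F) :: ('p ^ 'n ^ 'n) monoid) \<and> H \<noteq> {mat 1}
       \<longrightarrow> H \<inter> carrier (SL F) \<noteq> {mat 1}"
    proof (intro allI impI notI)
      fix H assume H: "central_subgroup H (SL (closure F) :: ('p ^ 'n ^ 'n) monoid) \<and> H \<noteq> {mat 1}"
        and trivial: "H \<inter> carrier (SL F) = {mat 1}"
      then have sub: "subgroup H (SL (closure F))" and center: "H \<subseteq> group_center (SL (closure F))"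
        by (auto simp: central_subgroup_def)
      have carr: "H \<subseteq> carrier (SL (closure F))"
        using sub by (rule subgroup.subset)
      \<comment> \<open>Being central over the closure, \<open>H\<close> consists of scalar
        matrices.\<close>
      interpret scalar_group F H
      proof
        fix h assume h: "h \<in> H"
        show "\<exists>z. h = mat z"
          using K.center_scalar center h by blast
        show "det h = 1"
          using carr h by (auto simp: SL_def)
        show "h ** h' \<in> H" if "h' \<in> H" for h'
          using subgroup.m_closed[OF sub h that] by (simp add: K.mult_SL)
        show "adjugate h \<in> H"
          using subgroup.m_inv_closed[OF sub h] carr h by (simp add: K.inv_SL subset_iff)
      next
        show "mat 1 \<in> H"
          using subgroup.one_closed[OF sub] by (simp add: SL_def)
      qed fact
      show False
        using minimal[OF group_topology_quotient] quotient_strictly_coarser[OF F(2) carr] H by blast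
    qed
  next
    assume essential: "\<forall>H. central_subgroup H (SL (closure F) :: ('p ^ 'n ^ 'n) monoid) \<and> H \<noteq> {mat 1}
       \<longrightarrow> H \<inter> carrier (SL F) \<noteq> {mat 1}"
    have "\<not> strictly_coarser T' (SL_topology F)"
      if T': "hausdorff_group_topology (SL F :: ('p ^ 'n ^ 'n) monoid) T'" for T'
    proof
      assume "strictly_coarser T' (SL_topology F)"
      then have sub: "{U. openin T' U} \<subset> {U. openin (SL_topology F) U}"
        by (simp add: strictly_coarser_def)
      \<comment> \<open>The two topologies turn out to coincide, against the strictness of the
        inclusion.\<close>
      then have "openin T' V" if "openin (SL_topology F) V" for V
        using essential that by (intro coarser_eq_if_essential[OF F T']) auto
      with sub show False
        by blast
    qed
    then show "minimal_topological_group (SL F :: ('p ^ 'n ^ 'n) monoid) (SL_topology F)"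
      using hausdorff_group_topology_SL[OF F(1)] by (auto simp: minimal_topological_group_def)
  qed
qed

end
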